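(* Let $T_\sigma$ be a pseudo-differential operator with symbol $\sigma\in S^0_{1,0}(\mathbb{T}\times\mathbb{Z})$, and fix $1<p<\infty$. Then $$\|T_\sigma-K\|_{\mathcal{L}(L^p(\mathbb{T}))}\ \ge\ d_\sigma$$ for every compact operator $K$ on $L^p(\mathbb{T})$, where $$d_\sigma:=\limsup_{|k|\to\infty}\Big\{\sup_{x\in\mathbb{T}}|\sigma(x,k)|\Big\}.$$
   Context: $\mathbb{T}=\mathbb{R}/2\pi\mathbb{Z}$ with normalized Haar measure $dx$; $\widehat f(k)=\int_{\mathbb{T}}f(x)e^{-ixk}\,dx$ for $k\in\mathbb{Z}$. For $m\in\mathbb{R}$ and $0\le\rho,\delta\le1$, the class $S^m_{\rho,\delta}(\mathbb{T}\times\mathbb{Z})$ consists of the functions $\sigma:\mathbb{T}\times\mathbb{Z}\to\mathbb{C}$, smooth in $x$, such that for all integers $t,r\ge0$ there is a constant $C_{t,r}>0$ with $|\Delta_k^tD_x^r\sigma(x,k)|\le C_{t,r}\langle k\rangle^{m-\rho t+\delta r}$ for all $(x,k)$, where $\langle k\rangle=(1+k^2)^{1/2}$, $\Delta_k^t\varphi(k)=\sum_{h=0}^t(-1)^{t-h}\binom{t}{h}\varphi(k+h)$, and $D_x^rf=(-i)^r\partial_x^rf$. The operator $T_\sigma$ is defined on trigonometric polynomials by $(T_\sigma f)(x)=\sum_{k\in\mathbb{Z}}\sigma(x,k)\widehat f(k)e^{ixk}$; for $\sigma\in S^0_{1,0}(\mathbb{T}\times\mathbb{Z})$ it extends to a bounded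 operator on $L^p(\mathbb{T})$, $1<p<\infty$, again denoted $T_\sigma$. $\mathcal{L}(E)$ denotes the bounded linear operators on a normed space $E$ with the operator norm. *)

theory Defs
  imports "HOL-Analysis.Analysis"
begin

text \<open>
  The circle \<open>\<real> / 2\<pi>\<int>\<close> is handled through the reals: symbols are \<open>2\<pi>\<close>-periodic functions of
  \<open>x :: real\<close>, and elements of \<open>L\<^sup>p\<close> are functions on the fundamental domain \<open>[0, 2\<pi>)\<close>, on which the
  measure below is concentrated (so their values elsewhere do not matter).
\<close>

definition circle :: "real measure" where
  "circle = uniform_measure lborel {0..<2 * pi}"

definition fourier_coeff :: "(real \<Rightarrow> complex) \<Rightarrow> int \<Rightarrow> complex" where
  "fourier_coeff f k = (LINT x|circle. f x * cis (- (x * real_of_int k)))"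

definition trig_poly :: "(real \<Rightarrow> complex) \<Rightarrow> bool" where
  "trig_poly f \<longleftrightarrow>
     (\<exists>(F :: int set) c. finite F \<and> f = (\<lambda>x. \<Sum>k\<in>F. c k * cis (x * real_of_int k)))"


subsection \<open>Symbols\<close>

definition iter_deriv :: "nat \<Rightarrow> (real \<Rightarrow> complex) \<Rightarrow> real \<Rightarrow> complex" where
  "iter_deriv r = ((\<lambda>g x. vector_derivative g (at x)) ^^ r)"

definition smooth :: "(real \<Rightarrow> complex) \<Rightarrow> bool" where
  "smooth f \<longleftrightarrow> (\<forall>r x. iter_deriv r f differentiable (at x))"

definition D_op :: "nat \<Rightarrow> (real \<Rightarrow> complex) \<Rightarrow> real \<Rightarrow> complex" where
  "D_op r f x = (- \<i>) ^ r * iter_deriv r f x"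

definition diff_op :: "nat \<Rightarrow> (int \<Rightarrow> complex) \<Rightarrow> int \<Rightarrow> complex" where
  "diff_op t \<phi> k = (\<Sum>h=0..t. (- 1) ^ (t - h) * of_nat (t choose h) * \<phi> (k + int h))"

definition jbracket :: "int \<Rightarrow> real" where
  "jbracket k = (1 + (real_of_int k)\<^sup>2) powr (1 / 2)"

definition symbol_class :: "real \<Rightarrow> real \<Rightarrow> real \<Rightarrow> (real \<Rightarrow> int \<Rightarrow> complex) set" where
  "symbol_class m \<rho> \<delta> = {\<sigma>.
     (\<forall>x k. \<sigma> (x + 2 * pi) k = \<sigma> x k) \<and>
     (\<forall>k. smooth (\<lambda>x. \<sigma> x k)) \<and>
     (\<forall>t r. \<exists>C>0. \<forall>x k.
        norm (diff_op t (\<lambda>j. D_op r (\<lambda>y. \<sigma> y j) x) k)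
          \<le> C * jbracket k powr (m - \<rho> * real t + \<delta> * real r))}"

text \<open>
  For trigonometric polynomials \<open>f\<close> the sum has only finitely many nonzero terms;
  the operator is only used on those.
\<close>

definition pdo :: "(real \<Rightarrow> int \<Rightarrow> complex) \<Rightarrow> (real \<Rightarrow> complex) \<Rightarrow> real \<Rightarrow> complex" where
  "pdo \<sigma> f x = (\<Sum>\<^sub>\<infinity>k. \<sigma> x k * fourier_coeff f k * cis (x * real_of_int k))"

definition symbol_limsup :: "(real \<Rightarrow> int \<Rightarrow> complex) \<Rightarrow> ereal" where
  "symbol_limsup \<sigma> =
     Limsup (filtercomap (\<lambda>k. \<bar>k\<bar>) at_top) (\<lambda>k. SUP x. ereal (norm (\<sigma> x k)))"


subsection \<open>Operators on \<open>L\<^sup>p\<close>\<close>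

text \<open>
  \<open>L\<^sup>p\<close> is represented by functions rather than by classes modulo null sets. Accordingly,
  \<open>Lp_norm\<close> is only a seminorm, and the linearity of operators is required almost everywhere.
  An operator that is bounded and linear in this sense maps a.e. equal functions to a.e. equal
  functions, so it is the same as a bounded linear operator on the quotient.
\<close>

definition Lp_space :: "real \<Rightarrow> (real \<Rightarrow> complex) set" where
  "Lp_space p =
     {f \<in> borel_measurable circle. integrable circle (\<lambda>x. norm (f x) powr p)}"

definition Lp_norm :: "real \<Rightarrow> (real \<Rightarrow> complex) \<Rightarrow> real" where
  "Lp_norm p f = (LINT x|circle. norm (f x) powr p) powr (1 / p)"

definition bounded_op :: "real \<Rightarrow> ((real \<Rightarrow> complex) \<Rightarrow> (real \<Rightarrow> complex)) \<Rightarrow> bool" where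
  "bounded_op p T \<longleftrightarrow>
     (\<forall>f\<in>Lp_space p. T f \<in> Lp_space p) \<and>
     (\<forall>f\<in>Lp_space p. \<forall>g\<in>Lp_space p.
        AE x in circle. T (\<lambda>y. f y + g y) x = T f x + T g x) \<and>
     (\<forall>c. \<forall>f\<in>Lp_space p. AE x in circle. T (\<lambda>y. c * f y) x = c * T f x) \<and>
     (\<exists>C. \<forall>f\<in>Lp_space p. Lp_norm p (T f) \<le> C * Lp_norm p f)"

definition op_norm :: "real \<Rightarrow> ((real \<Rightarrow> complex) \<Rightarrow> (real \<Rightarrow> complex)) \<Rightarrow> real" where
  "op_norm p T = Sup {Lp_norm p (T f) |f. f \<in> Lp_space p \<and> Lp_norm p f \<le> 1}"

text \<open>Relative compactness of the image of the unit ball is expressed by sequences.\<close>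

definition compact_op :: "real \<Rightarrow> ((real \<Rightarrow> complex) \<Rightarrow> (real \<Rightarrow> complex)) \<Rightarrow> bool" where
  "compact_op p K \<longleftrightarrow> bounded_op p K \<and>
     (\<forall>f :: nat \<Rightarrow> real \<Rightarrow> complex. (\<forall>n. f n \<in> Lp_space p \<and> Lp_norm p (f n) \<le> 1) \<longrightarrow>
        (\<exists>g\<in>Lp_space p. \<exists>s. strict_mono s \<and>
           (\<lambda>n. Lp_norm p (\<lambda>x. K (f (s n)) x - g x)) \<longlonglongrightarrow> 0))"

text \<open>
  \<open>T\<close> is the bounded extension of \<open>pdo \<sigma>\<close> from trigonometric polynomials to \<open>L\<^sup>p\<close>. Since these are
  dense for \<open>1 \<le> p < \<infinity>\<close>, it determines \<open>T\<close> up to equality almost everywhere.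
\<close>

definition is_pdo_extension ::
  "real \<Rightarrow> (real \<Rightarrow> int \<Rightarrow> complex) \<Rightarrow> ((real \<Rightarrow> complex) \<Rightarrow> (real \<Rightarrow> complex)) \<Rightarrow> bool" where
  "is_pdo_extension p \<sigma> T \<longleftrightarrow>
     bounded_op p T \<and> (\<forall>f. trig_poly f \<longrightarrow> (AE x in circle. T f x = pdo \<sigma> f x))"

end

theory Submission
  imports Defs
begin

text \<open>
  Why the bound holds: \<open>T\<close> acts on a function oscillating at a high frequency \<open>k\<close> almost like
  multiplication by \<open>\<sigma>(\<cdot>, k)\<close>, while a compact operator annihilates such functions in the limit.

  Fix a trigonometric polynomial \<open>g\<close> and modulate it: \<open>e\<^sub>k g\<close>, where \<open>e\<^sub>k x = cis (x * k)\<close>. The spectrum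
  of \<open>e\<^sub>k g\<close> lies within a bounded distance of \<open>k\<close>, and the first difference of a symbol of order
  \<open>0\<close> in its frequency argument is \<open>O(1 / \<bar>k\<bar>)\<close>. Freezing the frequency of the symbol
  at \<open>k\<close> therefore costs an error that is uniformly small in \<open>x\<close>, so that \<open>T (e\<^sub>k g)\<close> is uniformly close
  to \<open>\<sigma>(\<cdot>, k) e\<^sub>k g\<close> as \<open>\<bar>k\<bar> \<longrightarrow> \<infinity>\<close> (\<open>pdo_on_modulated\<close>).

  On the other hand, let \<open>f\<^sub>n\<close> be modulations of \<open>g\<close> by distinct frequencies \<open>k\<^sub>n\<close>. A subsequence of
  \<open>K f\<^sub>n\<close> tends to \<open>0\<close> in \<open>L\<^sup>p\<close> (\<open>compact_op_high_frequency\<close>). The textbook reason is weak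
  convergence of \<open>f\<^sub>n\<close> to \<open>0\<close>, which rests on the duality of \<open>L\<^sup>p\<close> spaces. The argument here uses averages
  instead: by compactness a subsequence of \<open>K f\<^sub>n\<close> converges to some \<open>G\<close>, hence so do its averages; but
  these are the images under \<open>K\<close> of averages of \<open>f\<^sub>n\<close>, which tend to \<open>0\<close> in \<open>L\<^sup>p\<close> because distinct
  exponentials are orthogonal and bounded. So \<open>G = 0\<close>.

  Suppose now that the norm \<open>A\<close> of \<open>T - K\<close> is smaller than the upper limit. Then there are a constant
  \<open>c > A\<close>, frequencies \<open>k\<^sub>n\<close> with \<open>\<bar>k\<^sub>n\<bar> \<longrightarrow> \<infinity>\<close> and points \<open>x\<^sub>n\<close> with \<open>\<bar>\<sigma>(x\<^sub>n, k\<^sub>n)\<bar> > c\<close>; the circle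
  being compact, \<open>x\<^sub>n\<close> may be taken to converge to some \<open>x\<^sub>0\<close>. The functions \<open>\<sigma>(\<cdot>, k)\<close> are
  Lipschitz with one common constant, so \<open>\<bar>\<sigma>(\<cdot>, k\<^sub>n)\<bar>\<close> still exceeds a constant \<open>c\<^sub>1 > A\<close> on a fixed interval
  near \<open>x\<^sub>0\<close>. Choose \<open>g\<close> of norm \<open>1\<close> with nearly all of its \<open>L\<^sup>p\<close> mass in this
  interval (\<open>concentrated_trig_poly\<close>). Then the norm of \<open>(T - K) f\<^sub>n\<close> is eventually larger than \<open>A\<close>,
  a contradiction.
\<close>

section \<open>Integration over the circle\<close>

lemma sets_circle [simp, measurable_cong]: "sets circle = sets borel"
  by (simp add: circle_def)

lemma space_circle [simp]: "space circle = UNIV"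
  by (simp add: circle_def)

lemma emeasure_circle_UNIV: "emeasure circle UNIV = 1"
proof -
  have "emeasure circle UNIV = emeasure lborel ({0..<2 * pi} \<inter> UNIV) / emeasure lborel {0..<2 * pi}"
    unfolding circle_def by (rule emeasure_uniform_measure) auto
  then show ?thesis by simp
qed

interpretation circle: finite_measure circle
  by (rule finite_measureI) (simp add: emeasure_circle_UNIV)

lemma measure_circle_UNIV [simp]: "measure circle UNIV = 1"
  by (simp add: measure_def emeasure_circle_UNIV)

lemma measure_circle_pos:
  assumes "0 \<le> a" "a < b" "b \<le> 2 * pi"
  shows "measure circle {a<..<b} > 0"
proof -
  have "{0..<2 * pi} \<inter> {a<..<b} = {a<..<b}" using assms by auto
  then have "measure circle {a<..<b} = (b - a) / (2 * pi)"
    unfolding circle_def using assms by (subst measure_uniform_measure) auto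
  then show ?thesis using assms by simp
qed

lemma AE_circle_fundamental: "AE x in circle. x \<in> {0<..<2 * pi}"
proof -
  have "AE x in lborel. x \<noteq> (0::real)" by (rule AE_lborel_singleton)
  then have "AE x in lborel. x \<in> {0..<2 * pi} \<longrightarrow> x \<in> {0<..<2 * pi}"
    by eventually_elim auto
  then show ?thesis unfolding circle_def by (intro AE_uniform_measureI) auto
qed

text \<open>
  The closed interval replaces the half-open one so that the fundamental theorem of calculus applies.
\<close>

lemma integral_circle:
  fixes f :: "real \<Rightarrow> 'a :: {banach, second_countable_topology}"
  assumes [measurable]: "f \<in> borel_measurable borel"
  shows "(LINT x|circle. f x) = (LINT x|lborel. indicator {0..2 * pi} x *\<^sub>R f x) /\<^sub>R (2 * pi)"
proof -
  have circle_density: "circle = density lborel (\<lambda>x. ennreal (indicator {0..<2 * pi} x / (2 * pi)))"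
    unfolding circle_def uniform_measure_def
    by (intro density_cong) (auto simp: divide_ennreal[symmetric] split: split_indicator)
  have "(LINT x|circle. f x) = (LINT x|lborel. (indicator {0..<2 * pi} x / (2 * pi)) *\<^sub>R f x)"
    unfolding circle_density by (rule integral_density) auto
  also have "\<dots> = (LINT x|lborel. (indicator {0..2 * pi} x *\<^sub>R f x) /\<^sub>R (2 * pi))"
  proof (rule integral_cong_AE)
    have "AE x in lborel. x \<noteq> 2 * pi" by (rule AE_lborel_singleton)
    then show "AE x in lborel. (indicator {0..<2 * pi} x / (2 * pi)) *\<^sub>R f x
        = (indicator {0..2 * pi} x *\<^sub>R f x) /\<^sub>R (2 * pi)"
    proof eventually_elim
      case (elim x)
      then have "indicator {0..<2 * pi} x = (indicator {0..2 * pi} x :: real)"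
        by (auto simp: indicator_def)
      then show ?case by (simp only: divide_inverse scaleR_scaleR mult.commute)
    qed
  qed measurable
  finally show ?thesis by (simp only: integral_scaleR_right)
qed

lemma integrable_circle_bounded:
  fixes f :: "real \<Rightarrow> 'a :: {banach, second_countable_topology}"
  assumes "f \<in> borel_measurable borel" "\<And>x. norm (f x) \<le> B"
  shows "integrable circle f"
  using assms by (intro circle.integrable_const_bound[of _ B]) auto

lemma borel_measurable_cis [measurable]: "cis \<in> borel_measurable borel"
  by (intro borel_measurable_continuous_onI continuous_intros)

section \<open>The seminormed spaces \<open>L\<^sup>p\<close>\<close>

lemma Lp_spaceI:
  assumes "f \<in> borel_measurable borel" "integrable circle (\<lambda>x. norm (f x) powr p)"
  shows "f \<in> Lp_space p"
  using assms by (simp add: Lp_space_def cong: measurable_cong_sets)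

lemma Lp_space_measurable [measurable_dest]: "f \<in> Lp_space p \<Longrightarrow> f \<in> borel_measurable borel"
  by (simp add: Lp_space_def cong: measurable_cong_sets)

lemma Lp_space_integrable: "f \<in> Lp_space p \<Longrightarrow> integrable circle (\<lambda>x. norm (f x) powr p)"
  by (simp add: Lp_space_def)

lemma Lp_norm_nonneg [simp]: "Lp_norm p f \<ge> 0"
  by (simp add: Lp_norm_def)

lemma Lp_norm_powr:
  assumes "p > 0"
  shows "Lp_norm p f powr p = (LINT x|circle. norm (f x) powr p)"
  using assms by (simp add: Lp_norm_def powr_powr)

lemma Lp_space_dominated:
  assumes "g \<in> Lp_space p" "f \<in> borel_measurable borel" "p > 0"
    and "AE x in circle. norm (f x) \<le> norm (g x)"
  shows "f \<in> Lp_space p"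
proof (rule Lp_spaceI)
  have [measurable]: "f \<in> borel_measurable borel" by fact
  show "integrable circle (\<lambda>x. norm (f x) powr p)"
    by (rule Bochner_Integration.integrable_bound[OF Lp_space_integrable[OF assms(1)]])
       (use assms(3,4) in \<open>auto elim!: eventually_mono intro: powr_mono2\<close>)
qed fact

lemma Lp_norm_mono:
  assumes "g \<in> Lp_space p" "p > 0" "AE x in circle. norm (f x) \<le> norm (g x)"
  shows "Lp_norm p f \<le> Lp_norm p g"
  unfolding Lp_norm_def
proof (rule powr_mono2)
  show "(LINT x|circle. norm (f x) powr p) \<le> (LINT x|circle. norm (g x) powr p)"
    by (rule integral_mono_AE'[OF Lp_space_integrable[OF assms(1)]])
       (use assms(2,3) in \<open>auto elim!: eventually_mono intro: powr_mono2\<close>)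
qed (use assms in auto)

lemma Lp_norm_cong_AE:
  assumes "f \<in> Lp_space p" "g \<in> Lp_space p" "p > 0" "AE x in circle. f x = g x"
  shows "Lp_norm p f = Lp_norm p g"
proof (rule antisym)
  show "Lp_norm p f \<le> Lp_norm p g"
    by (rule Lp_norm_mono) (use assms in \<open>auto elim!: eventually_mono\<close>)
  show "Lp_norm p g \<le> Lp_norm p f"
    by (rule Lp_norm_mono) (use assms in \<open>auto elim!: eventually_mono\<close>)
qed

lemma bounded_in_Lp_space:
  assumes "f \<in> borel_measurable borel" "p > 0" "\<And>x. norm (f x) \<le> B"
  shows "f \<in> Lp_space p"
proof (rule Lp_space_dominated)
  show "(\<lambda>_. of_real \<bar>B\<bar>) \<in> Lp_space p" by (rule Lp_spaceI) auto
  have "norm (f x) \<le> \<bar>B\<bar>" for x using assms(3)[of x] by linarith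
  then show "AE x in circle. norm (f x) \<le> norm (complex_of_real \<bar>B\<bar>)" by simp
qed fact+

lemma Lp_norm_const: "p > 0 \<Longrightarrow> Lp_norm p (\<lambda>_. c) = norm c"
  by (simp add: Lp_norm_def powr_powr)

lemma Lp_norm_le_bound:
  assumes "p > 0" "B \<ge> 0" "\<And>x. norm (f x) \<le> B"
  shows "Lp_norm p f \<le> B"
proof -
  have "Lp_norm p f \<le> Lp_norm p (\<lambda>_. of_real B)"
    by (rule Lp_norm_mono) (use assms in \<open>auto intro: Lp_spaceI\<close>)
  then show ?thesis using assms by (simp add: Lp_norm_const)
qed

lemma Lp_space_scale:
  assumes "f \<in> Lp_space p"
  shows "(\<lambda>x. c * f x) \<in> Lp_space p"
proof (rule Lp_spaceI)
  have [measurable]: "f \<in> borel_measurable borel" using assms by measurable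
  show "(\<lambda>x. c * f x) \<in> borel_measurable borel" by measurable
  show "integrable circle (\<lambda>x. norm (c * f x) powr p)"
    using Lp_space_integrable[OF assms] by (simp add: norm_mult powr_mult)
qed

lemma Lp_norm_scale:
  assumes "p > 0"
  shows "Lp_norm p (\<lambda>x. c * f x) = norm c * Lp_norm p f"
  using assms by (simp add: Lp_norm_def norm_mult powr_mult powr_powr)

text \<open>
  Minkowski's inequality is applied to functions that may vanish, so convexity is needed up to the
  boundary point \<open>0\<close>, where it reduces to \<open>c powr p \<le> c\<close> for \<open>0 \<le> c \<le> 1\<close>.
\<close>

lemma powr_convex_nonneg:
  fixes u v :: real
  assumes "p \<ge> 1" "u \<ge> 0" "v \<ge> 0" "0 \<le> l" "0 \<le> m" "l + m = 1"
  shows "(l * u + m * v) powr p \<le> l * u powr p + m * v powr p"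
proof -
  have zero: "(c * w) powr p \<le> c * w powr p" if "0 \<le> c" "c \<le> 1" "w \<ge> 0" for c w :: real
  proof -
    have "c powr p \<le> c"
      using powr_mono'[of 1 p c] that assms(1) by simp
    then show ?thesis using that by (simp add: powr_mult mult_right_mono)
  qed
  consider "u = 0" | "v = 0" | "u > 0" "v > 0" using assms by linarith
  then show ?thesis
  proof cases
    case 3
    have "convex_on {0<..} (\<lambda>x::real. x powr p)" using assms(1) by (rule powr_convex)
    moreover have "l = 1 - m" using assms(6) by simp
    ultimately show ?thesis
      using convex_onD[of "{0<..}" "\<lambda>x::real. x powr p" m u v] 3 assms(4,5) by simp
  qed (use assms zero[of m v] zero[of l u] in auto)
qed

text \<open>
  Minkowski's inequality, by the convexity of \<open>t \<mapsto> t powr p\<close> applied to the convex combination of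
  \<open>\<bar>f\<bar> / a\<close> and \<open>\<bar>g\<bar> / b\<close> with weights \<open>a / (a + b)\<close> and \<open>b / (a + b)\<close>. With positive upper bounds
  \<open>a\<close> and \<open>b\<close> in place of the norms, functions of seminorm \<open>0\<close> need no separate treatment.
\<close>

lemma Lp_space_add_norm_le:
  assumes f: "f \<in> Lp_space p" and g: "g \<in> Lp_space p" and p: "p \<ge> 1"
    and a: "Lp_norm p f \<le> a" "a > 0" and b: "Lp_norm p g \<le> b" "b > 0"
  shows "(\<lambda>x. f x + g x) \<in> Lp_space p \<and> Lp_norm p (\<lambda>x. f x + g x) \<le> a + b"
proof -
  have fm [measurable]: "f \<in> borel_measurable borel" and gm [measurable]: "g \<in> borel_measurable borel"
    using f g by measurable
  let ?h = "\<lambda>x. norm (f x + g x) powr p"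
  let ?F = "\<lambda>x. (a + b) powr p * (a / (a + b) * (norm (f x) powr p / a powr p)
                  + b / (a + b) * (norm (g x) powr p / b powr p))"
  have le: "?h x \<le> ?F x" for x
  proof -
    have "norm (f x + g x) \<le> (a + b) * (a / (a + b) * (norm (f x) / a) + b / (a + b) * (norm (g x) / b))"
    proof -
      have "a / (a + b) * (norm (f x) / a) = norm (f x) / (a + b)"
        and "b / (a + b) * (norm (g x) / b) = norm (g x) / (a + b)" and "a + b \<noteq> 0"
        using a b by auto
      moreover from this have "(a + b) * (s / (a + b) + t / (a + b)) = s + t" for s t :: real
        by (simp add: distrib_left)
      ultimately show ?thesis
        using norm_triangle_ineq[of "f x" "g x"] by (simp only:)
    qed
    then have "?h x \<le> ((a + b) * (a / (a + b) * (norm (f x) / a) + b / (a + b) * (norm (g x) / b))) powr p"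
      using p by (intro powr_mono2) auto
    also have "\<dots> = (a + b) powr p * (a / (a + b) * (norm (f x) / a) + b / (a + b) * (norm (g x) / b)) powr p"
      using a b by (subst powr_mult) auto
    also have "\<dots> \<le> (a + b) powr p * (a / (a + b) * (norm (f x) / a) powr p + b / (a + b) * (norm (g x) / b) powr p)"
      using p a b by (intro mult_left_mono powr_convex_nonneg) (auto simp: add_divide_distrib[symmetric])
    also have "\<dots> = ?F x"
      using a b by (simp add: powr_divide)
    finally show ?thesis .
  qed
  have intF: "integrable circle ?F"
    using Lp_space_integrable[OF f] Lp_space_integrable[OF g] by auto
  have inth: "integrable circle ?h"
    by (rule Bochner_Integration.integrable_bound[OF intF]) (use le in \<open>auto intro: order_trans[OF _ abs_ge_self]\<close>)
  have fa: "(LINT x|circle. norm (f x) powr p) \<le> a powr p"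
    using a p powr_mono2[of p "Lp_norm p f" a] by (simp add: Lp_norm_powr)
  have gb: "(LINT x|circle. norm (g x) powr p) \<le> b powr p"
    using b p powr_mono2[of p "Lp_norm p g" b] by (simp add: Lp_norm_powr)
  have "(LINT x|circle. ?h x) \<le> (LINT x|circle. ?F x)"
    by (rule integral_mono[OF inth intF le])
  also have "\<dots> = (a + b) powr p * (a / (a + b) * ((LINT x|circle. norm (f x) powr p) / a powr p)
                  + b / (a + b) * ((LINT x|circle. norm (g x) powr p) / b powr p))"
    using Lp_space_integrable[OF f] Lp_space_integrable[OF g] by simp
  also have "\<dots> \<le> (a + b) powr p * (a / (a + b) * 1 + b / (a + b) * 1)"
    using a b fa gb by (intro mult_left_mono add_mono) auto
  also have "\<dots> = (a + b) powr p"
    using a b by (simp add: add_divide_distrib[symmetric])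
  finally have "Lp_norm p (\<lambda>x. f x + g x) \<le> ((a + b) powr p) powr (1 / p)"
    unfolding Lp_norm_def using p by (intro powr_mono2) auto
  then have "Lp_norm p (\<lambda>x. f x + g x) \<le> a + b"
    using p a b by (simp add: powr_powr)
  with inth show ?thesis by (auto intro!: Lp_spaceI)
qed

lemma Lp_space_add:
  assumes "f \<in> Lp_space p" "g \<in> Lp_space p" "p \<ge> 1"
  shows "(\<lambda>x. f x + g x) \<in> Lp_space p"
  using Lp_space_add_norm_le[OF assms, of "Lp_norm p f + 1" "Lp_norm p g + 1"]
  by (simp add: add_nonneg_pos)

lemma Lp_norm_triangle:
  assumes "f \<in> Lp_space p" "g \<in> Lp_space p" "p \<ge> 1"
  shows "Lp_norm p (\<lambda>x. f x + g x) \<le> Lp_norm p f + Lp_norm p g"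
proof (rule field_le_epsilon)
  fix e :: real assume "e > 0"
  then show "Lp_norm p (\<lambda>x. f x + g x) \<le> Lp_norm p f + Lp_norm p g + e"
    using Lp_space_add_norm_le[OF assms, of "Lp_norm p f + e / 2" "Lp_norm p g + e / 2"]
    by (simp add: add_nonneg_pos)
qed

lemma Lp_space_diff:
  assumes "f \<in> Lp_space p" "g \<in> Lp_space p" "p \<ge> 1"
  shows "(\<lambda>x. f x - g x) \<in> Lp_space p"
  using Lp_space_add[OF assms(1) Lp_space_scale[OF assms(2), of "- 1"] assms(3)] by simp

lemma Lp_norm_diff:
  assumes "f \<in> Lp_space p" "g \<in> Lp_space p" "p \<ge> 1"
  shows "Lp_norm p (\<lambda>x. f x - g x) \<le> Lp_norm p f + Lp_norm p g"
  using Lp_norm_triangle[OF assms(1) Lp_space_scale[OF assms(2), of "- 1"] assms(3)]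
        Lp_norm_scale[of p "-1" g] assms(3) by simp

lemma zero_in_Lp_space [simp]: "(\<lambda>_. 0) \<in> Lp_space p"
  by (rule Lp_spaceI) auto

lemma Lp_norm_zero [simp]: "Lp_norm p (\<lambda>_. 0) = 0"
  by (simp add: Lp_norm_def)

lemma Lp_space_sum:
  assumes "\<And>i. i \<in> I \<Longrightarrow> f i \<in> Lp_space p" "p \<ge> 1"
  shows "(\<lambda>x. \<Sum>i\<in>I. f i x) \<in> Lp_space p"
proof (cases "finite I")
  case True
  then show ?thesis using assms
    by (induction I) (auto intro: Lp_space_add)
qed simp

lemma Lp_norm_sum:
  assumes "\<And>i. i \<in> I \<Longrightarrow> f i \<in> Lp_space p" "p \<ge> 1"
  shows "Lp_norm p (\<lambda>x. \<Sum>i\<in>I. f i x) \<le> (\<Sum>i\<in>I. Lp_norm p (f i))"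
proof (cases "finite I")
  case True
  then show ?thesis using assms
  proof (induction I)
    case (insert i I)
    have "Lp_norm p (\<lambda>x. f i x + (\<Sum>i\<in>I. f i x)) \<le> Lp_norm p (f i) + Lp_norm p (\<lambda>x. \<Sum>i\<in>I. f i x)"
      using insert.prems by (intro Lp_norm_triangle Lp_space_sum) auto
    with insert show ?case by auto
  qed simp
qed simp

lemma Lp_norm_modulate: "Lp_norm p (\<lambda>x. cis (h x) * g x) = Lp_norm p g"
  by (simp add: Lp_norm_def norm_mult)

section \<open>Bounded operators on \<open>L\<^sup>p\<close>\<close>

lemma bounded_opD:
  assumes "bounded_op p K" "f \<in> Lp_space p"
  shows bounded_op_in_Lp: "K f \<in> Lp_space p"
    and bounded_op_add: "g \<in> Lp_space p \<Longrightarrow> AE x in circle. K (\<lambda>y. f y + g y) x = K f x + K g x"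
    and bounded_op_scale: "AE x in circle. K (\<lambda>y. c * f y) x = c * K f x"
  using assms unfolding bounded_op_def by auto

lemma bounded_op_sum:
  assumes "bounded_op p K" "p \<ge> 1" "finite I" "\<And>i. i \<in> I \<Longrightarrow> f i \<in> Lp_space p"
  shows "AE x in circle. K (\<lambda>y. \<Sum>i\<in>I. f i y) x = (\<Sum>i\<in>I. K (f i) x)"
  using assms(3,4)
proof (induction I)
  case empty
  show ?case using bounded_op_scale[OF assms(1) zero_in_Lp_space, of 0] by simp
next
  case (insert i I)
  have "AE x in circle. K (\<lambda>y. f i y + (\<Sum>i\<in>I. f i y)) x = K (f i) x + K (\<lambda>y. \<Sum>i\<in>I. f i y) x"
    using insert.prems assms(2) by (intro bounded_op_add[OF assms(1)] Lp_space_sum) auto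
  moreover have "AE x in circle. K (\<lambda>y. \<Sum>i\<in>I. f i y) x = (\<Sum>i\<in>I. K (f i) x)"
    using insert by auto
  ultimately show ?case by eventually_elim (simp add: insert.hyps)
qed

lemma bounded_op_bound:
  assumes "bounded_op p K"
  obtains C where "C \<ge> 0" "\<And>f. f \<in> Lp_space p \<Longrightarrow> Lp_norm p (K f) \<le> C * Lp_norm p f"
proof -
  obtain C where C: "\<And>f. f \<in> Lp_space p \<Longrightarrow> Lp_norm p (K f) \<le> C * Lp_norm p f"
    using assms unfolding bounded_op_def by blast
  have "Lp_norm p (K f) \<le> \<bar>C\<bar> * Lp_norm p f" if "f \<in> Lp_space p" for f
    using C[OF that] mult_right_mono[OF abs_ge_self[of C], of "Lp_norm p f"] by simp
  then show ?thesis by (intro that[of "\<bar>C\<bar>"]) auto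
qed

text \<open>
  The supremum of a set of reals bounds its elements only if the set is bounded above; this is where the
  boundedness of both operators enters.
\<close>

lemma op_norm_upper:
  assumes T: "bounded_op p T" and K: "bounded_op p K" and "p \<ge> 1"
    and "f \<in> Lp_space p" "Lp_norm p f \<le> 1"
  shows "Lp_norm p (\<lambda>x. T f x - K f x) \<le> op_norm p (\<lambda>f x. T f x - K f x)"
proof -
  obtain C where C: "C \<ge> 0" "\<And>f. f \<in> Lp_space p \<Longrightarrow> Lp_norm p (T f) \<le> C * Lp_norm p f"
    using bounded_op_bound[OF T] by metis
  obtain D where D: "D \<ge> 0" "\<And>f. f \<in> Lp_space p \<Longrightarrow> Lp_norm p (K f) \<le> D * Lp_norm p f"
    using bounded_op_bound[OF K] by metis
  have "Lp_norm p (\<lambda>x. T h x - K h x) \<le> C + D" if "h \<in> Lp_space p" "Lp_norm p h \<le> 1" for h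
  proof -
    have "Lp_norm p (\<lambda>x. T h x - K h x) \<le> Lp_norm p (T h) + Lp_norm p (K h)"
      using T K that assms(3) by (intro Lp_norm_diff) (auto simp: bounded_op_def)
    also have "\<dots> \<le> C * Lp_norm p h + D * Lp_norm p h"
      using C D that by (intro add_mono) auto
    also have "\<dots> \<le> C * 1 + D * 1"
      using C D that by (intro add_mono mult_left_mono) auto
    finally show ?thesis by simp
  qed
  then show ?thesis
    unfolding op_norm_def using assms(4,5)
    by (intro cSup_upper) (auto intro!: bdd_aboveI[of _ "C + D"])
qed

section \<open>Exponential sums and trigonometric polynomials\<close>

lemma integrable_circle_cis: "integrable circle (\<lambda>x. cis (x * real_of_int k))"
proof (rule integrable_circle_bounded)
  show "norm (cis (x * real_of_int k)) \<le> 1" for x by simp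
qed measurable

lemma integral_circle_cis:
  "(LINT x|circle. cis (x * real_of_int k)) = (if k = 0 then 1 else 0)"
proof (cases "k = 0")
  case False
  let ?F = "\<lambda>x::real. cis (x * real_of_int k) / (\<i> * of_int k)"
  have deriv: "(?F has_vector_derivative cis (x * real_of_int k)) (at x within A)" for x A
  proof -
    have "((\<lambda>x::real. cis (x * real_of_int k)) has_vector_derivative
        real_of_int k *\<^sub>R (\<i> * cis (x * real_of_int k))) (at x within A)"
      unfolding has_vector_derivative_def
      by (rule has_derivative_eq_rhs, rule has_derivative_cis) (auto intro!: derivative_eq_intros)
    from has_vector_derivative_divide[OF this, of "\<i> * of_int k"] False show ?thesis
      by (simp add: scaleR_conv_of_real)
  qed
  have "(LINT x|lborel. indicator {0..2 * pi} x *\<^sub>R cis (x * real_of_int k)) = ?F (2 * pi) - ?F 0"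
    by (intro integral_FTC_atLeastAtMost deriv) (auto intro!: continuous_intros)
  also have "cis (2 * pi * real_of_int k) = 1"
    by (rule cis_multiple_2pi) auto
  finally show ?thesis using False by (simp add: integral_circle)
qed simp

lemma cis_freq_diff:
  "cis (x * real_of_int k) * cis (- (x * real_of_int l)) = cis (x * real_of_int (k - l))"
  by (simp add: cis_mult algebra_simps)

lemma fourier_coeff_trig_poly:
  assumes "finite F"
  shows "fourier_coeff (\<lambda>x. \<Sum>k\<in>F. c k * cis (x * real_of_int k)) m = (if m \<in> F then c m else 0)"
proof -
  have "fourier_coeff (\<lambda>x. \<Sum>k\<in>F. c k * cis (x * real_of_int k)) m
      = (LINT x|circle. (\<Sum>k\<in>F. c k * cis (x * real_of_int (k - m))))"
    unfolding fourier_coeff_def by (simp only: sum_distrib_right mult.assoc cis_freq_diff)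
  also have "\<dots> = (\<Sum>k\<in>F. c k * (LINT x|circle. cis (x * real_of_int (k - m))))"
    using integrable_circle_cis
    by (subst Bochner_Integration.integral_sum) (auto simp del: of_int_diff)
  also have "\<dots> = (\<Sum>k\<in>F. if m = k then c k else 0)"
    unfolding integral_circle_cis by (intro sum.cong) auto
  finally show ?thesis using assms by simp
qed

lemma integral_exp_sum_square:
  assumes "finite F"
  shows "(LINT x|circle. (norm (\<Sum>k\<in>F. cis (x * real_of_int k)))\<^sup>2) = card F"
proof -
  have "complex_of_real (LINT x|circle. (norm (\<Sum>k\<in>F. cis (x * real_of_int k)))\<^sup>2)
      = (LINT x|circle. complex_of_real ((norm (\<Sum>k\<in>F. cis (x * real_of_int k)))\<^sup>2))"
    by (simp only: integral_complex_of_real)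
  also have "\<dots> = (LINT x|circle. (\<Sum>k\<in>F. \<Sum>l\<in>F. cis (x * real_of_int (k - l))))"
    by (intro Bochner_Integration.integral_cong refl)
       (simp only: complex_norm_square cnj_sum cis_cnj sum_product cis_freq_diff)
  also have "\<dots> = (\<Sum>k\<in>F. \<Sum>l\<in>F. if k = l then 1 else 0)"
    using integrable_circle_cis
    by (simp del: of_int_diff add: Bochner_Integration.integral_sum integral_circle_cis)
  also have "\<dots> = complex_of_real (card F)" using assms by simp
  finally show ?thesis by (simp only: of_real_eq_iff)
qed

text \<open>
  For a function with values in \<open>[0, 1]\<close> this controls its \<open>L\<^sup>p\<close> norm by its \<open>L\<^sup>2\<close> norm, for \<open>p < 2\<close> and
  \<open>p \<ge> 2\<close> alike: a value \<open>t > d\<close> satisfies \<open>t powr p \<le> 1 \<le> (t / d)\<^sup>2\<close>.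
\<close>

lemma powr_le_powr_plus_square:
  fixes t d p :: real
  assumes "0 \<le> t" "t \<le> 1" "d > 0" "p > 0"
  shows "t powr p \<le> d powr p + t\<^sup>2 / d\<^sup>2"
proof (cases "t \<le> d")
  case True
  then have "t powr p \<le> d powr p" using assms by (intro powr_mono2) auto
  also have "\<dots> \<le> d powr p + t\<^sup>2 / d\<^sup>2" by simp
  finally show ?thesis .
next
  case False
  then have "d\<^sup>2 \<le> t\<^sup>2" using assms by (intro power_mono) auto
  then have "1 \<le> t\<^sup>2 / d\<^sup>2" using assms by simp
  moreover have "t powr p \<le> 1" using assms by (simp add: powr_le1)
  ultimately show ?thesis by (simp add: add_increasing)
qed

text \<open>
  The average of \<open>n\<close> distinct exponentials is bounded by \<open>1\<close> and, by orthogonality, has square mean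
  \<open>1 / n\<close>. Hence it is small in every \<open>L\<^sup>p\<close>, uniformly in the choice of the frequencies.
\<close>

lemma exp_average_Lp_small:
  fixes \<delta> :: real
  assumes p: "p > 0" and \<delta>: "\<delta> > 0"
  obtains N where "N > 0"
    "\<And>F. finite F \<Longrightarrow> card F \<ge> N
       \<Longrightarrow> Lp_norm p (\<lambda>x. \<Sum>k\<in>F. cis (x * real_of_int k)) \<le> card F * \<delta>"
proof -
  \<comment> \<open>\<open>d powr p\<close> is half of \<open>\<delta> powr p\<close>; the other half is left for the square mean.\<close>
  define d where "d = \<delta> / 2 powr (1 / p)"
  have d: "d > 0" using \<delta> by (simp add: d_def)
  have dp: "2 * d powr p = \<delta> powr p"
    using p \<delta> by (simp add: d_def powr_divide powr_powr)
  obtain N0 :: nat where "real N0 \<ge> 1 / (d powr p * d\<^sup>2)"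
    using real_arch_simple by blast
  then obtain N :: nat where N: "real N \<ge> 1 / (d powr p * d\<^sup>2)" "N > 0"
    by (intro that[of "Suc N0"]) auto
  show ?thesis
  proof (rule that[OF N(2)])
    fix F :: "int set" assume F: "finite F" "card F \<ge> N"
    have cF: "real (card F) > 0" using F N by simp
    let ?E = "\<lambda>x. \<Sum>k\<in>F. cis (x * real_of_int k)"
    let ?A = "\<lambda>x. of_real (1 / card F) * ?E x"
    have normA: "norm (?A x) = norm (?E x) / card F" for x
      by (simp add: norm_mult norm_divide)
    have "norm (?E x) \<le> card F" for x
      using norm_sum[of "\<lambda>k. cis (x * real_of_int k)" F] by simp
    then have A1: "norm (?A x) \<le> 1" for x using cF by (simp only: normA) simp
    have int: "integrable circle (\<lambda>x. norm (?A x) powr p)"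
      using p A1 by (intro integrable_circle_bounded[of _ 1]) (auto intro!: powr_le1)
    have intE: "integrable circle (\<lambda>x. (norm (?E x))\<^sup>2)"
      using \<open>\<And>x. norm (?E x) \<le> card F\<close>
      by (intro integrable_circle_bounded[of _ "(card F)\<^sup>2"]) (auto intro!: power_mono)
    have "(LINT x|circle. norm (?A x) powr p)
        \<le> (LINT x|circle. d powr p + (norm (?E x))\<^sup>2 / ((card F)\<^sup>2 * d\<^sup>2))"
    proof (rule integral_mono[OF int])
      show "integrable circle (\<lambda>x. d powr p + (norm (?E x))\<^sup>2 / ((card F)\<^sup>2 * d\<^sup>2))"
        using intE by auto
      show "norm (?A x) powr p \<le> d powr p + (norm (?E x))\<^sup>2 / ((card F)\<^sup>2 * d\<^sup>2)" for x
        using powr_le_powr_plus_square[OF norm_ge_zero A1 d p, of x]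
        by (simp only: normA power_divide divide_divide_eq_left of_nat_power)
    qed
    also have "\<dots> = d powr p + card F / ((card F)\<^sup>2 * d\<^sup>2)"
      using intE by (simp add: integral_exp_sum_square[OF F(1)])
    also have "\<dots> = d powr p + 1 / (card F * d\<^sup>2)"
      using cF by (simp add: power2_eq_square)
    also have "\<dots> \<le> d powr p + d powr p"
    proof -
      have "1 / (d powr p * d\<^sup>2) \<le> card F" using N(1) F(2) by linarith
      then show ?thesis using d cF by (simp add: field_simps)
    qed
    also have "\<dots> = \<delta> powr p" using dp by simp
    finally have "Lp_norm p ?A \<le> (\<delta> powr p) powr (1 / p)"
      unfolding Lp_norm_def using p by (intro powr_mono2) auto
    then have "Lp_norm p ?A \<le> \<delta>" using p \<delta> by (simp add: powr_powr)
    then have "Lp_norm p ?E / card F \<le> \<delta>"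
      using Lp_norm_scale[OF p, of "of_real (1 / card F)" ?E] by (simp add: norm_divide)
    then show "Lp_norm p ?E \<le> card F * \<delta>" using cF by (simp add: field_simps)
  qed
qed

lemma modulated_trig_poly:
  "cis (x * real_of_int k) * (\<Sum>j\<in>F. c j * cis (x * real_of_int j))
    = (\<Sum>j\<in>F. c j * cis (x * real_of_int (k + j)))"
  unfolding sum_distrib_left
  by (intro sum.cong refl) (simp add: cis_mult distrib_left mult.left_commute)

lemma trig_poly_modulate:
  assumes "trig_poly g"
  shows "trig_poly (\<lambda>x. cis (x * real_of_int k) * g x)"
proof -
  obtain F c where F: "finite F" and g: "g = (\<lambda>x. \<Sum>j\<in>F. c j * cis (x * real_of_int j))"
    using assms unfolding trig_poly_def by blast
  have inj: "inj_on ((+) k) F" by simp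
  have eq: "(\<lambda>x. cis (x * real_of_int k) * g x)
      = (\<lambda>x. \<Sum>m\<in>(+) k ` F. c (m - k) * cis (x * real_of_int m))"
    unfolding g modulated_trig_poly sum.reindex[OF inj] by simp
  show ?thesis unfolding trig_poly_def by (rule exI, rule exI, rule conjI[OF _ eq]) (simp add: F)
qed

lemma trig_poly_measurable:
  assumes "trig_poly g"
  shows "g \<in> borel_measurable borel"
proof -
  obtain F c where "g = (\<lambda>x. \<Sum>j\<in>F. c j * cis (x * real_of_int j))"
    using assms unfolding trig_poly_def by blast
  then show ?thesis by simp
qed

lemma trig_poly_bounded:
  assumes "trig_poly g"
  obtains B where "\<And>x. norm (g x) \<le> B"
proof -
  obtain F c where g: "g = (\<lambda>x. \<Sum>j\<in>F. c j * cis (x * real_of_int j))"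
    using assms unfolding trig_poly_def by blast
  have "norm (g x) \<le> (\<Sum>j\<in>F. norm (c j))" for x
    unfolding g by (rule sum_norm_le) (simp add: norm_mult)
  then show ?thesis by (rule that)
qed

section \<open>Compact operators at high frequencies\<close>

text \<open>
  Compactness gives a subsequence along which the images converge to some \<open>G\<close>. A sum of \<open>N\<close> images far
  out in the subsequence is close to \<open>N G\<close>; it is also the image of a sum of \<open>N\<close> modulations of \<open>g\<close>, whose
  norm is \<open>o(N)\<close> by the smallness of averages of exponentials. So the seminorm of \<open>G\<close> is \<open>0\<close>.
\<close>

lemma compact_op_high_frequency:
  assumes K: "compact_op p K" and p: "p > 1"
    and g [measurable]: "g \<in> borel_measurable borel" and B: "\<And>x. norm (g x) \<le> B"
    and g1: "Lp_norm p g \<le> 1" and k: "inj (k :: nat \<Rightarrow> int)"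
  shows "\<exists>s. strict_mono s \<and>
    (\<lambda>n. Lp_norm p (K (\<lambda>x. cis (x * real_of_int (k (s n))) * g x))) \<longlonglongrightarrow> 0"
proof -
  define f where "f = (\<lambda>n x. cis (x * real_of_int (k n)) * g x)"
  have bK: "bounded_op p K" using K by (simp add: compact_op_def)
  have B0: "B \<ge> 0" using B[of 0] norm_ge_zero order_trans by blast
  have p0: "p > 0" "p \<ge> 1" using p by auto
  have f: "f n \<in> Lp_space p" for n
    unfolding f_def using p B by (intro bounded_in_Lp_space[where B = B]) (auto simp: norm_mult)
  have Kf: "K (f n) \<in> Lp_space p" for n by (rule bounded_op_in_Lp[OF bK f])
  have f1: "Lp_norm p (f n) \<le> 1" for n
    unfolding f_def Lp_norm_modulate by (rule g1)
  obtain G s where G: "G \<in> Lp_space p" and s: "strict_mono s"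
    and lim: "(\<lambda>n. Lp_norm p (\<lambda>x. K (f (s n)) x - G x)) \<longlonglongrightarrow> 0"
    using K f f1 unfolding compact_op_def by blast
  obtain C where C: "C \<ge> 0" "\<And>f. f \<in> Lp_space p \<Longrightarrow> Lp_norm p (K f) \<le> C * Lp_norm p f"
    using bounded_op_bound[OF bK] by metis
  have "Lp_norm p G \<le> 0 + e" if e: "e > 0" for e
  proof -
    obtain n0 where n0: "\<And>n. n \<ge> n0 \<Longrightarrow> Lp_norm p (\<lambda>x. K (f (s n)) x - G x) < e / 2"
      using order_tendstoD(2)[OF lim, of "e / 2"] e by (auto simp: eventually_sequentially)
    \<comment> \<open>The summand \<open>1\<close> only keeps \<open>D\<close> positive when \<open>C\<close> or \<open>B\<close> vanishes.\<close>
    define D where "D = C * B + 1"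
    have D: "D > 0" unfolding D_def using C B0 by (simp add: add_nonneg_pos)
    define \<delta> where "\<delta> = e / (2 * D)"
    have \<delta>: "\<delta> > 0" using e D by (simp add: \<delta>_def)
    obtain N where N: "N > 0" "\<And>F. finite F \<Longrightarrow> card F \<ge> N
       \<Longrightarrow> Lp_norm p (\<lambda>x. \<Sum>k\<in>F. cis (x * real_of_int k)) \<le> card F * \<delta>"
      using exp_average_Lp_small[OF p0(1) \<delta>] by metis
    define J where "J = {n0..<n0 + N}"
    have inj: "inj_on (k \<circ> s) J"
      by (rule inj_on_subset[OF inj_compose[OF k strict_mono_imp_inj_on[OF s]]]) simp
    let ?E = "\<lambda>x. \<Sum>m\<in>(k \<circ> s) ` J. cis (x * real_of_int m)"
    have E: "Lp_norm p ?E \<le> N * \<delta>"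
      using N(2)[of "(k \<circ> s) ` J"] card_image[OF inj] by (simp add: J_def)
    let ?h = "\<lambda>x. \<Sum>n\<in>J. f (s n) x"
    have h: "?h \<in> Lp_space p" using f p0 by (intro Lp_space_sum)
    have hE: "?h x = ?E x * g x" for x
      unfolding sum.reindex[OF inj] f_def by (simp add: sum_distrib_right)
    have "Lp_norm p ?h \<le> Lp_norm p (\<lambda>x. of_real B * ?E x)"
    proof (rule Lp_norm_mono[OF _ p0(1)])
      show "(\<lambda>x. of_real B * ?E x) \<in> Lp_space p"
        by (intro Lp_space_scale Lp_space_sum p0 bounded_in_Lp_space[where B = 1]) auto
      show "AE x in circle. norm (?h x) \<le> norm (of_real B * ?E x)"
      proof (rule AE_I2)
        fix x
        show "norm (?h x) \<le> norm (of_real B * ?E x)"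
          unfolding hE norm_mult using B0 mult_left_mono[OF B[of x] norm_ge_zero[of "?E x"]]
          by (simp only: norm_of_real abs_of_nonneg mult.commute)
      qed
    qed
    also have "\<dots> \<le> B * (N * \<delta>)"
      unfolding Lp_norm_scale[OF p0(1)] using B0 E by (simp add: mult_left_mono)
    finally have "C * Lp_norm p ?h \<le> C * (B * (N * \<delta>))" using C by (intro mult_left_mono)
    with C(2)[OF h] have Kh: "Lp_norm p (K ?h) \<le> C * (B * (N * \<delta>))" by linarith
    have AE: "AE x in circle. K ?h x = (\<Sum>n\<in>J. K (f (s n)) x)"
      using f p0 by (intro bounded_op_sum[OF bK]) (auto simp: J_def)
    have "Lp_norm p (\<lambda>x. of_nat N * G x)
        \<le> Lp_norm p (\<lambda>x. \<Sum>n\<in>J. K (f (s n)) x) + Lp_norm p (\<lambda>x. \<Sum>n\<in>J. K (f (s n)) x - G x)"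
    proof -
      have "of_nat N * G x = (\<Sum>n\<in>J. K (f (s n)) x) - (\<Sum>n\<in>J. K (f (s n)) x - G x)" for x
        by (simp add: sum_subtractf J_def)
      then show ?thesis
        by (simp only:) (intro Lp_norm_diff Lp_space_sum Lp_space_diff Kf G p0)
    qed
    also have "Lp_norm p (\<lambda>x. \<Sum>n\<in>J. K (f (s n)) x) = Lp_norm p (K ?h)"
      using AE by (intro Lp_norm_cong_AE[OF _ bounded_op_in_Lp[OF bK h]] Lp_space_sum Kf p0) auto
    also have "Lp_norm p (\<lambda>x. \<Sum>n\<in>J. K (f (s n)) x - G x) \<le> (\<Sum>n\<in>J. Lp_norm p (\<lambda>x. K (f (s n)) x - G x))"
      by (intro Lp_norm_sum Lp_space_diff Kf G p0)
    also have "\<dots> \<le> (\<Sum>n\<in>J. e / 2)"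
      using n0 by (intro sum_mono) (auto simp: J_def less_imp_le)
    finally have "N * Lp_norm p G \<le> C * (B * (N * \<delta>)) + N * (e / 2)"
      using Kh by (simp add: Lp_norm_scale[OF p0(1)] J_def)
    then have "N * Lp_norm p G \<le> N * (C * B * \<delta> + e / 2)"
      by (simp add: algebra_simps)
    then have "Lp_norm p G \<le> C * B * \<delta> + e / 2"
      using N(1) by simp
    also have "C * B * \<delta> \<le> D * \<delta>" using \<delta> by (simp add: D_def)
    also have "\<dots> = e / 2" using D by (simp add: \<delta>_def)
    finally show ?thesis by simp
  qed
  then have "Lp_norm p G \<le> 0" by (rule field_le_epsilon)
  then have G0: "Lp_norm p G = 0" using Lp_norm_nonneg[of p G] by linarith
  have "(\<lambda>n. Lp_norm p (K (f (s n)))) \<longlonglongrightarrow> 0"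
  proof (rule real_tendsto_sandwich[OF _ _ tendsto_const lim])
    have "Lp_norm p (K (f (s n))) \<le> Lp_norm p (\<lambda>x. K (f (s n)) x - G x)" for n
      using Lp_norm_triangle[OF Lp_space_diff[OF Kf[of "s n"] G p0(2)] G p0(2)] G0 by simp
    then show "\<forall>\<^sub>F n in sequentially. Lp_norm p (K (f (s n))) \<le> Lp_norm p (\<lambda>x. K (f (s n)) x - G x)"
      by simp
  qed simp
  with s show ?thesis unfolding f_def by blast
qed

section \<open>Trigonometric polynomials concentrated in an interval\<close>

text \<open>
  \<open>1 + cis y = 2 cos (y / 2) cis (y / 2)\<close>.
\<close>

lemma norm_one_plus_cis: "norm ((1 + cis y) / 2) = \<bar>cos (y / 2)\<bar>"
proof -
  have "cos y = 2 * (cos (y / 2))\<^sup>2 - 1" "sin y = 2 * sin (y / 2) * cos (y / 2)"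
    using cos_double_cos[of "y / 2"] sin_double[of "y / 2"] by simp_all
  then have "(1 + cis y) / 2 = of_real (cos (y / 2)) * cis (y / 2)"
    by (simp add: complex_eq_iff power2_eq_square)
  then show ?thesis by (simp add: norm_mult)
qed

lemma trig_poly_binomial_kernel:
  "trig_poly (\<lambda>x. A * ((1 + cis (x - y)) / 2) ^ N)"
proof -
  let ?c = "\<lambda>k. A * (of_nat (N choose nat k) * cis (- (y * real_of_int k)) / 2 ^ N)"
  have "A * ((1 + cis (x - y)) / 2) ^ N = (\<Sum>k\<in>int ` {..N}. ?c k * cis (x * real_of_int k))" for x
  proof -
    have "((1 + cis (x - y)) / 2) ^ N
        = (\<Sum>j\<le>N. of_nat (N choose j) * cis (x - y) ^ j) / 2 ^ N"
      using binomial_ring[of "cis (x - y)" 1 N]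
      by (simp only: power_divide power_one mult_1_right add.commute)
    moreover have "cis (x - y) ^ j = cis (- (y * real j)) * cis (x * real j)" for j
      by (simp add: Complex.DeMoivre cis_mult algebra_simps)
    ultimately show ?thesis
      by (simp add: sum.reindex sum_distrib_left sum_divide_distrib mult.assoc)
  qed
  then have eq: "(\<lambda>x. A * ((1 + cis (x - y)) / 2) ^ N)
      = (\<lambda>x. \<Sum>k\<in>int ` {..N}. ?c k * cis (x * real_of_int k))" by (rule ext)
  show ?thesis unfolding trig_poly_def by (rule exI, rule exI, rule conjI[OF _ eq]) simp
qed

text \<open>
  With \<open>y\<close> the midpoint of the interval, \<open>u(x) = (1 + cis (x - y)) / 2\<close> has modulus \<open>\<bar>cos ((x - y) / 2)\<bar>\<close>,
  which peaks at \<open>y\<close>: it is at most \<open>q\<close> in the rest of the period and at least \<open>w > q\<close> on its middle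
  half \<open>I\<close>. In the power \<open>u ^ N\<close> the mass outside is at most \<open>q powr (N p)\<close>, and the mass inside is at least
  \<open>m w powr (N p)\<close> with \<open>m\<close> the measure of \<open>I\<close>; as \<open>(q / w) ^ N \<longrightarrow> 0\<close>, the latter dominates for large \<open>N\<close>.
\<close>

lemma concentrated_trig_poly:
  assumes p: "p > 0" and ab: "0 \<le> a" "a < b" "b \<le> 2 * pi" and \<theta>: "0 \<le> \<theta>" "\<theta> < 1"
  obtains g where "trig_poly g" "Lp_norm p g = 1"
    "\<theta> \<le> Lp_norm p (\<lambda>x. indicator {a<..<b} x * g x)"
proof -
  define y where "y = (a + b) / 2"
  define r where "r = (b - a) / 2"
  define q where "q = cos (r / 2)"
  define w where "w = cos (r / 4)"
  define u where "u = (\<lambda>x. (1 + cis (x - y)) / 2)"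
  define I where "I = {y - r / 2<..<y + r / 2}"
  have r: "0 < r" using ab by (simp add: r_def)
  have "r \<le> y" using ab by (simp add: r_def y_def)
  moreover have "y \<le> 2 * pi - r" using ab by (simp add: r_def y_def diff_divide_distrib add_divide_distrib)
  ultimately have yr: "r \<le> y" "y \<le> 2 * pi - r" "r \<le> pi" by linarith+
  have S: "{a<..<b} = {y - r<..<y + r}" by (auto simp: y_def r_def field_simps)
  have q: "0 \<le> q" unfolding q_def using r yr by (intro cos_ge_zero) auto
  have qw: "q < w" unfolding q_def w_def using r yr by (intro cos_monotone_0_pi) auto
  then have w: "w > 0" using q by linarith
  have u: "norm (u x) = \<bar>cos (\<bar>x - y\<bar> / 2)\<bar>" for x
    unfolding u_def norm_one_plus_cis using cos_abs_real[of "(x - y) / 2"] by (simp add: abs_divide)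
  have far: "norm (u x) \<le> q" if "x \<in> {0<..<2 * pi}" "x \<notin> {a<..<b}" for x
  proof -
    define t where "t = \<bar>x - y\<bar> / 2"
    have t: "r / 2 \<le> t" "t \<le> pi - r / 2" using that yr unfolding S t_def by auto
    have "cos t \<le> cos (r / 2)" using t r yr by (intro cos_monotone_0_pi_le) auto
    moreover have "cos (pi - t) \<le> cos (r / 2)" using t r yr by (intro cos_monotone_0_pi_le) auto
    ultimately show ?thesis unfolding u t_def[symmetric] q_def by (simp add: abs_le_iff)
  qed
  have near: "w \<le> norm (u x)" if "x \<in> I" for x
  proof -
    have "cos (r / 4) \<le> cos (\<bar>x - y\<bar> / 2)"
      using that r yr by (intro cos_monotone_0_pi_le) (auto simp: I_def abs_if)
    then show ?thesis unfolding u w_def by simp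
  qed
  have IS: "I \<subseteq> {a<..<b}"
    unfolding I_def S using r by (intro greaterThanLessThan_subseteq_greaterThanLessThan[THEN iffD2]) simp
  define m where "m = measure circle I"
  have m: "m > 0" unfolding m_def I_def using r yr by (intro measure_circle_pos) linarith+
  \<comment> \<open>If the mass outside is at most \<open>(1 - \<theta> powr p)\<close> times the mass inside, then the mass inside is at least
    \<open>\<theta> powr p\<close> times the total; \<open>\<kappa>\<close> is what this asks of \<open>(q / w) powr (N p)\<close>.\<close>
  define \<kappa> where "\<kappa> = (1 - \<theta> powr p) * m"
  have "\<theta> powr p < 1" using \<theta> p powr_less_mono2[of p \<theta> 1] by simp
  then have \<kappa>: "\<kappa> > 0" using m by (simp add: \<kappa>_def)
  obtain N where N: "(q / w) ^ N < \<kappa> powr (1 / p)"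
  proof -
    have "\<kappa> powr (1 / p) > 0" "q / w < 1" using \<kappa> w qw by simp_all
    from real_arch_pow_inv[OF this] show ?thesis using that by blast
  qed
  have qN: "(q ^ N) powr p \<le> \<kappa> * (w ^ N) powr p"
  proof -
    have "q ^ N \<le> \<kappa> powr (1 / p) * w ^ N"
      using N w by (simp add: power_divide divide_less_eq)
    then have "(q ^ N) powr p \<le> (\<kappa> powr (1 / p) * w ^ N) powr p"
      using q p by (intro powr_mono2) auto
    then show ?thesis using \<kappa> p by (simp add: powr_mult powr_powr)
  qed
  define g where "g = (\<lambda>x. u x ^ N)"
  have um: "u \<in> borel_measurable borel" unfolding u_def by measurable
  then have gm [measurable]: "g \<in> borel_measurable borel" unfolding g_def by measurable
  have g1: "norm (g x) \<le> 1" for x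
    unfolding g_def norm_power u by (intro power_le_one) auto
  let ?gS = "\<lambda>x. indicator {a<..<b} x * g x"
  have gL: "g \<in> Lp_space p" using gm p g1 by (rule bounded_in_Lp_space)
  have gSL: "?gS \<in> Lp_space p"
    by (rule Lp_space_dominated[OF gL _ p]) (auto split: split_indicator)
  define Tot where "Tot = (LINT x|circle. norm (g x) powr p)"
  define Loc where "Loc = (LINT x|circle. norm (?gS x) powr p)"
  have Tot_le: "Tot \<le> Loc + (q ^ N) powr p"
  proof -
    have "Tot \<le> (LINT x|circle. norm (?gS x) powr p + (q ^ N) powr p)"
      unfolding Tot_def
    proof (rule integral_mono_AE)
      show "AE x in circle. norm (g x) powr p \<le> norm (?gS x) powr p + (q ^ N) powr p"
        using AE_circle_fundamental
      proof eventually_elim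
        case (elim x)
        show ?case
        proof (cases "x \<in> {a<..<b}")
          case False
          have "norm (g x) \<le> q ^ N"
            unfolding g_def norm_power by (rule power_mono[OF far[OF elim False] norm_ge_zero])
          then have "norm (g x) powr p \<le> (q ^ N) powr p" using p by (intro powr_mono2) auto
          then show ?thesis using False by simp
        qed simp
      qed
      show "integrable circle (\<lambda>x. norm (g x) powr p)" by (rule Lp_space_integrable[OF gL])
      show "integrable circle (\<lambda>x. norm (?gS x) powr p + (q ^ N) powr p)"
        by (intro Bochner_Integration.integrable_add Lp_space_integrable[OF gSL]) simp
    qed
    also have "\<dots> = Loc + (q ^ N) powr p"
      unfolding Loc_def using Lp_space_integrable[OF gSL] by simp
    finally show ?thesis .
  qed
  have Loc_ge: "m * (w ^ N) powr p \<le> Loc"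
  proof -
    have "(LINT x|circle. indicator I x * (w ^ N) powr p) \<le> Loc"
      unfolding Loc_def
    proof (rule integral_mono'[OF Lp_space_integrable[OF gSL]])
      fix x
      show "indicator I x * (w ^ N) powr p \<le> norm (?gS x) powr p"
      proof (cases "x \<in> I")
        case True
        have "w ^ N \<le> norm (g x)"
          unfolding g_def norm_power using near[OF True] w by (intro power_mono) auto
        then have "(w ^ N) powr p \<le> norm (g x) powr p" using p w by (intro powr_mono2) auto
        moreover have "x \<in> {a<..<b}" using True IS by blast
        ultimately show ?thesis using True by simp
      qed simp
      show "0 \<le> norm (?gS x) powr p" by (rule powr_ge_zero)
    qed
    then show ?thesis by (simp add: m_def I_def)
  qed
  have LocT: "\<theta> powr p * Tot \<le> Loc"
  proof -
    have "(q ^ N) powr p \<le> (1 - \<theta> powr p) * (m * (w ^ N) powr p)"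
      using qN by (simp add: \<kappa>_def mult.assoc)
    also have "\<dots> \<le> (1 - \<theta> powr p) * Loc"
      using \<open>\<theta> powr p < 1\<close> Loc_ge by (intro mult_left_mono) auto
    finally have 1: "(q ^ N) powr p \<le> (1 - \<theta> powr p) * Loc" .
    have "\<theta> powr p * Tot \<le> \<theta> powr p * Loc + \<theta> powr p * (q ^ N) powr p"
      using mult_left_mono[OF Tot_le, of "\<theta> powr p"] by (simp add: distrib_left)
    also have "\<theta> powr p * (q ^ N) powr p \<le> 1 * (q ^ N) powr p"
      using \<open>\<theta> powr p < 1\<close> by (intro mult_right_mono) auto
    finally show ?thesis using 1 by (simp add: algebra_simps)
  qed
  have loc: "\<theta> * Lp_norm p g \<le> Lp_norm p ?gS"
  proof -
    have "(\<theta> powr p * Tot) powr (1 / p) \<le> Loc powr (1 / p)"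
      using LocT p by (intro powr_mono2) (auto simp: Tot_def)
    then show ?thesis
      using p \<theta> by (simp add: Lp_norm_def Tot_def Loc_def powr_mult powr_powr)
  qed
  have "0 < m * (w ^ N) powr p" using m w by simp
  also have "\<dots> \<le> Loc" by (rule Loc_ge)
  also have "\<dots> \<le> Tot"
    unfolding Loc_def Tot_def
    by (rule integral_mono'[OF Lp_space_integrable[OF gL]]) (auto split: split_indicator)
  finally have L: "Lp_norm p g > 0" by (simp add: Lp_norm_def Tot_def)
  let ?A = "complex_of_real (1 / Lp_norm p g)"
  from L have nA: "norm ?A = 1 / Lp_norm p g" by (simp add: norm_divide)
  show ?thesis
  proof (rule that)
    show "trig_poly (\<lambda>x. ?A * g x)"
      unfolding g_def u_def by (rule trig_poly_binomial_kernel)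
    show "Lp_norm p (\<lambda>x. ?A * g x) = 1"
      unfolding Lp_norm_scale[OF p] nA using L by simp
    have "indicator {a<..<b} x * (?A * g x) = ?A * ?gS x" for x by (rule mult.left_commute)
    then have "Lp_norm p (\<lambda>x. indicator {a<..<b} x * (?A * g x)) = Lp_norm p (\<lambda>x. ?A * ?gS x)"
      by (simp only:)
    also have "\<dots> = Lp_norm p ?gS / Lp_norm p g"
      unfolding Lp_norm_scale[OF p] nA by simp
    also have "\<dots> \<ge> \<theta>" using loc L by (simp add: pos_le_divide_eq)
    finally show "\<theta> \<le> Lp_norm p (\<lambda>x. indicator {a<..<b} x * (?A * g x))" .
  qed
qed

section \<open>Symbols of order zero\<close>

text \<open>
  The filter \<open>\<bar>k\<bar> \<longrightarrow> \<infinity>\<close> along which the upper limit of the symbol is taken.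
\<close>

abbreviation freq_at_infinity :: "int filter" where
  "freq_at_infinity \<equiv> filtercomap (\<lambda>k. \<bar>k\<bar>) at_top"

lemma filterlim_int_shift: "filterlim (\<lambda>k. k + j) freq_at_infinity freq_at_infinity"
  unfolding filterlim_iff eventually_filtercomap_at_top_linorder
proof (intro allI impI)
  fix P assume "\<exists>N. \<forall>k::int. N \<le> \<bar>k\<bar> \<longrightarrow> P k"
  then obtain N where N: "\<And>k::int. N \<le> \<bar>k\<bar> \<Longrightarrow> P k" by blast
  show "\<exists>N. \<forall>k. N \<le> \<bar>k\<bar> \<longrightarrow> P (k + j)"
    by (rule exI[of _ "N + \<bar>j\<bar>"]) (auto intro!: N)
qed

lemma diff_op_0 [simp]: "diff_op 0 \<phi> k = \<phi> k"
  by (simp add: diff_op_def)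

lemma diff_op_1: "diff_op (Suc 0) \<phi> k = \<phi> (k + 1) - \<phi> k"
  by (simp add: diff_op_def)

lemma jbracket_pos: "jbracket k > 0"
proof -
  have "1 + (real_of_int k)\<^sup>2 > 0" by (simp add: add_pos_nonneg)
  then show ?thesis by (simp add: jbracket_def)
qed

lemma abs_le_jbracket: "\<bar>real_of_int k\<bar> \<le> jbracket k"
proof -
  have "\<bar>real_of_int k\<bar> = sqrt ((real_of_int k)\<^sup>2)" by simp
  also have "\<dots> \<le> sqrt (1 + (real_of_int k)\<^sup>2)" by (intro real_sqrt_le_mono) simp
  also have "\<dots> = jbracket k" unfolding jbracket_def by (simp add: powr_half_sqrt)
  finally show ?thesis .
qed

lemma symbol_differentiable:
  assumes "\<sigma> \<in> symbol_class m \<rho> \<delta>"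
  shows "(\<lambda>x. \<sigma> x k) differentiable (at x)"
proof -
  have "smooth (\<lambda>x. \<sigma> x k)" using assms by (simp add: symbol_class_def)
  then have "iter_deriv 0 (\<lambda>x. \<sigma> x k) differentiable (at x)" unfolding smooth_def by blast
  then show ?thesis by (simp add: iter_deriv_def)
qed

lemma symbol_measurable:
  assumes "\<sigma> \<in> symbol_class m \<rho> \<delta>"
  shows "(\<lambda>x. \<sigma> x k) \<in> borel_measurable borel"
  by (intro borel_measurable_continuous_onI continuous_at_imp_continuous_on ballI
      differentiable_imp_continuous_within symbol_differentiable[OF assms])

lemma symbol_periodic:
  assumes "\<sigma> \<in> symbol_class m \<rho> \<delta>"
  obtains x' where "x' \<in> {0..2 * pi}" "\<And>k. \<sigma> x' k = \<sigma> x k"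
proof -
  have per: "\<sigma> (x + 2 * pi) k = \<sigma> x k" for x k using assms by (simp add: symbol_class_def)
  have pern: "\<sigma> (x + real n * (2 * pi)) k = \<sigma> x k" for x k n
  proof (induction n)
    case (Suc n)
    then show ?case using per[of "x + real n * (2 * pi)" k] by (simp add: distrib_right add_ac)
  qed simp
  define N where "N = \<lfloor>x / (2 * pi)\<rfloor>"
  have x': "x - real_of_int N * (2 * pi) \<in> {0..2 * pi}"
    using floor_correct[of "x / (2 * pi)"] unfolding N_def[symmetric]
    by (simp add: field_simps)
  have "\<sigma> (x - real_of_int N * (2 * pi)) k = \<sigma> x k" for k
  proof (cases "N \<ge> 0")
    case True
    then show ?thesis using pern[of "x - real_of_int N * (2 * pi)" "nat N" k] by simp
  next
    case False
    then show ?thesis using pern[of x "nat (- N)" k] by simp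
  qed
  with x' show ?thesis by (rule that)
qed

text \<open>
  The estimate for one \<open>x\<close>-derivative and no difference has weight \<open>\<langle>k\<rangle> powr 0\<close>, so the mean value inequality
  yields one Lipschitz constant for all frequencies.
\<close>

lemma symbol_lipschitz:
  assumes \<sigma>: "\<sigma> \<in> symbol_class 0 1 0"
  obtains L where "L > 0" "\<And>x y k. norm (\<sigma> x k - \<sigma> y k) \<le> L * \<bar>x - y\<bar>"
proof -
  have "\<exists>C>0. \<forall>x k. norm (diff_op 0 (\<lambda>j. D_op 1 (\<lambda>y. \<sigma> y j) x) k)
      \<le> C * jbracket k powr (0 - 1 * real 0 + 0 * real 1)"
    using \<sigma> unfolding symbol_class_def by blast
  then obtain C where C: "C > 0"
    and le: "\<And>x k. norm (diff_op 0 (\<lambda>j. D_op 1 (\<lambda>y. \<sigma> y j) x) k) \<le> C * jbracket k powr 0"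
    by auto
  have D: "norm (vector_derivative (\<lambda>y. \<sigma> y k) (at x)) \<le> C" for x k
    using le[of x k] jbracket_pos[of k] by (simp add: D_op_def iter_deriv_def norm_mult)
  have "norm (\<sigma> x k - \<sigma> y k) \<le> C * norm (x - y)" for x y k
  proof (rule differentiable_bound[OF convex_UNIV _ _ UNIV_I UNIV_I])
    fix z :: real
    show "((\<lambda>y. \<sigma> y k) has_derivative (\<lambda>h. h *\<^sub>R vector_derivative (\<lambda>y. \<sigma> y k) (at z))) (at z within UNIV)"
      using symbol_differentiable[OF \<sigma>, of k z]
      by (simp add: vector_derivative_works has_vector_derivative_def)
    show "onorm (\<lambda>h. h *\<^sub>R vector_derivative (\<lambda>y. \<sigma> y k) (at z)) \<le> C"
      by (rule onorm_le) (use mult_left_mono[OF D[of k z] abs_ge_zero] in \<open>simp add: mult.commute\<close>)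
  qed
  with C show ?thesis by (intro that[of C]) auto
qed

text \<open>
  The estimate for one difference and no derivative bounds the step by \<open>C / \<langle>k\<rangle>\<close>.
\<close>

lemma symbol_step_small:
  assumes \<sigma>: "\<sigma> \<in> symbol_class 0 1 0" and e: "e > 0"
  shows "\<forall>\<^sub>F k in freq_at_infinity. \<forall>x. norm (\<sigma> x (k + 1) - \<sigma> x k) < e"
proof -
  have "\<exists>C>0. \<forall>x k. norm (diff_op 1 (\<lambda>j. D_op 0 (\<lambda>y. \<sigma> y j) x) k)
      \<le> C * jbracket k powr (0 - 1 * real 1 + 0 * real 0)"
    using \<sigma> unfolding symbol_class_def by blast
  then obtain C where C: "C > 0"
    and le: "\<And>x k. norm (diff_op 1 (\<lambda>j. D_op 0 (\<lambda>y. \<sigma> y j) x) k) \<le> C * jbracket k powr (- 1)"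
    by auto
  obtain R :: nat where R: "C / e < real R" using reals_Archimedean2 by blast
  have "norm (\<sigma> x (k + 1) - \<sigma> x k) < e" if "int R \<le> \<bar>k\<bar>" for x k
  proof -
    have "C / e < \<bar>real_of_int k\<bar>" using R that by linarith
    also note abs_le_jbracket
    finally have "C / jbracket k < e"
      using e jbracket_pos[of k] by (simp add: divide_less_eq mult.commute)
    moreover have "norm (\<sigma> x (k + 1) - \<sigma> x k) \<le> C / jbracket k"
      using le[of x k] jbracket_pos[of k]
      by (simp add: diff_op_1 D_op_def iter_deriv_def powr_minus_divide)
    ultimately show ?thesis by linarith
  qed
  then show ?thesis unfolding eventually_filtercomap_at_top_linorder by blast
qed

text \<open>
  A shift by \<open>j\<close> is made of \<open>\<bar>j\<bar>\<close> unit steps; a shift to the left by \<open>n\<close> is a shift to the right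
  by \<open>n\<close> that starts at \<open>k - n\<close>.
\<close>

lemma symbol_shift_small:
  assumes \<sigma>: "\<sigma> \<in> symbol_class 0 1 0" and e: "e > 0"
  shows "\<forall>\<^sub>F k in freq_at_infinity. \<forall>x. norm (\<sigma> x (k + j) - \<sigma> x k) < e"
proof -
  have shift: "\<forall>\<^sub>F k in freq_at_infinity. \<forall>x. norm (\<sigma> x (k + int n) - \<sigma> x k) < e" if "e > 0" for n e
    using that
  proof (induction n arbitrary: e)
    case (Suc n)
    have "\<forall>\<^sub>F k in freq_at_infinity. \<forall>x. norm (\<sigma> x (k + int n) - \<sigma> x k) < e / 2"
      by (rule Suc.IH) (use Suc.prems in simp)
    moreover have "\<forall>\<^sub>F k in freq_at_infinity. \<forall>x. norm (\<sigma> x (k + int n + 1) - \<sigma> x (k + int n)) < e / 2"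
      by (rule eventually_compose_filterlim[OF symbol_step_small[OF \<sigma>] filterlim_int_shift])
         (use Suc.prems in simp)
    ultimately show ?case
    proof eventually_elim
      case (elim k)
      show ?case
      proof
        fix x
        have Suc_eq: "k + int (Suc n) = k + int n + 1" by simp
        show "norm (\<sigma> x (k + int (Suc n)) - \<sigma> x k) < e"
          using norm_diff_triangle_less[OF elim(2)[rule_format, of x] elim(1)[rule_format, of x]]
          unfolding Suc_eq by simp
      qed
    qed
  qed simp
  show ?thesis
  proof (cases "j \<ge> 0")
    case True
    then show ?thesis using shift[OF e, of "nat j"] by simp
  next
    case False
    define n where "n = nat (- j)"
    have j: "j = - int n" using False by (simp add: n_def)
    have "\<forall>\<^sub>F k in freq_at_infinity. \<forall>x. norm (\<sigma> x (k + j + int n) - \<sigma> x (k + j)) < e"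
      by (rule eventually_compose_filterlim[OF shift[OF e] filterlim_int_shift])
    then show ?thesis by (simp add: j norm_minus_commute)
  qed
qed

lemma frequently_symbol_large:
  assumes "ereal A < symbol_limsup \<sigma>"
  obtains c where "A < c" "\<And>N. \<exists>k x. \<bar>k\<bar> > N \<and> c < norm (\<sigma> x k)"
proof -
  obtain c where c: "A < c" "ereal c < symbol_limsup \<sigma>"
    using ereal_dense2[OF assms] by auto
  have "\<exists>k x. \<bar>k\<bar> > N \<and> c < norm (\<sigma> x k)" for N
  proof (rule ccontr)
    assume "\<not> ?thesis"
    then have "norm (\<sigma> x k) \<le> c" if "N + 1 \<le> \<bar>k\<bar>" for x k
      using that by (meson not_le zless_add1_eq add1_zle_eq)
    then have "(SUP x. ereal (norm (\<sigma> x k))) \<le> ereal c" if "N + 1 \<le> \<bar>k\<bar>" for k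
      using that by (intro SUP_least) simp
    then have "symbol_limsup \<sigma> \<le> ereal c"
      unfolding symbol_limsup_def
      by (intro Limsup_bounded) (auto simp: eventually_filtercomap_at_top_linorder)
    with c(2) show False by simp
  qed
  with c(1) show ?thesis by (rule that)
qed

text \<open>
  By periodicity the points can be taken in \<open>[0, 2\<pi>]\<close>, which is compact. Choosing the frequencies with strictly
  increasing absolute values makes them distinct, as the averaging argument for compact operators
  requires, and this survives passing to a subsequence.
\<close>

lemma large_symbol_sequence:
  assumes \<sigma>: "\<sigma> \<in> symbol_class m \<rho> \<delta>"
    and large: "\<And>N. \<exists>k x. \<bar>k\<bar> > N \<and> c < norm (\<sigma> x k)"
  obtains k :: "nat \<Rightarrow> int" and x x0 where "inj k" "filterlim k freq_at_infinity sequentially"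
    "x \<longlonglongrightarrow> x0" "x0 \<in> {0..2 * pi}" "\<And>n. c < norm (\<sigma> (x n) (k n))"
proof -
  have large': "\<exists>k x. \<bar>k\<bar> > N \<and> x \<in> {0..2 * pi} \<and> c < norm (\<sigma> x k)" for N
  proof -
    obtain k x where kx: "\<bar>k\<bar> > N" "c < norm (\<sigma> x k)" using large by blast
    obtain x' where "x' \<in> {0..2 * pi}" "\<And>k. \<sigma> x' k = \<sigma> x k"
      using symbol_periodic[OF \<sigma>] by metis
    with kx show ?thesis by metis
  qed
  let ?P = "\<lambda>n z. \<bar>fst z\<bar> \<ge> int n \<and> snd z \<in> {0..2 * pi} \<and> c < norm (\<sigma> (snd z) (fst z))"
  have "\<exists>f. \<forall>n. ?P n (f n) \<and> \<bar>fst (f n)\<bar> < \<bar>fst (f (Suc n))\<bar>"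
  proof (rule dependent_nat_choice)
    obtain k x where "\<bar>k\<bar> > 0" "x \<in> {0..2 * pi}" "c < norm (\<sigma> x k)"
      using large'[of 0] by blast
    then show "\<exists>z. ?P 0 z" by (intro exI[of _ "(k, x)"]) simp
  next
    fix z n assume "?P n z"
    obtain k x where "\<bar>k\<bar> > max \<bar>fst z\<bar> (int n)" "x \<in> {0..2 * pi}" "c < norm (\<sigma> x k)"
      using large' by blast
    then show "\<exists>y. ?P (Suc n) y \<and> \<bar>fst z\<bar> < \<bar>fst y\<bar>" by (intro exI[of _ "(k, x)"]) simp
  qed
  then obtain f where f: "\<And>n. ?P n (f n)" and mono: "\<And>n. \<bar>fst (f n)\<bar> < \<bar>fst (f (Suc n))\<bar>"
    by metis
  obtain x0 r where x0: "x0 \<in> {0..2 * pi}" and r: "strict_mono r"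
    and lim: "((\<lambda>n. snd (f n)) \<circ> r) \<longlonglongrightarrow> x0"
    using compact_Icc[of 0 "2 * pi", unfolded compact_eq_seq_compact_metric seq_compact_def] f
    by metis
  show ?thesis
  proof (rule that[OF _ _ lim x0])
    have "strict_mono (\<lambda>n. \<bar>fst (f n)\<bar>)" using mono by (rule strict_mono_Suc_iff[THEN iffD2, rule_format])
    then have "inj (\<lambda>n. \<bar>fst (f n)\<bar>)" by (rule strict_mono_imp_inj_on)
    then have "inj (\<lambda>n. fst (f n))" unfolding inj_def by metis
    then have "inj ((\<lambda>n. fst (f n)) \<circ> r)"
      by (rule inj_compose[OF _ strict_mono_imp_inj_on[OF r]])
    then show "inj (\<lambda>n. fst (f (r n)))" by (simp add: comp_def)
    have "int n \<le> \<bar>fst (f (r n))\<bar>" for n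
    proof -
      have "n \<le> r n" by (rule strict_mono_imp_increasing[OF r])
      then have "int n \<le> int (r n)" by simp
      also have "\<dots> \<le> \<bar>fst (f (r n))\<bar>" using f by blast
      finally show ?thesis .
    qed
    then show "filterlim (\<lambda>n. fst (f (r n))) freq_at_infinity sequentially"
      unfolding filterlim_filtercomap_iff comp_def
      by (intro filterlim_at_top_mono[OF filterlim_int_sequentially]) simp
    show "c < norm (\<sigma> (((\<lambda>n. snd (f n)) \<circ> r) n) (fst (f (r n))))" for n
      using f by simp
  qed
qed

section \<open>Pseudo-differential operators on modulated trigonometric polynomials\<close>

lemma pdo_trig_poly:
  assumes "finite F"
  shows "pdo \<sigma> (\<lambda>x. \<Sum>k\<in>F. c k * cis (x * real_of_int k)) x
    = (\<Sum>k\<in>F. \<sigma> x k * c k * cis (x * real_of_int k))"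
proof -
  have "pdo \<sigma> (\<lambda>x. \<Sum>k\<in>F. c k * cis (x * real_of_int k)) x
      = (\<Sum>\<^sub>\<infinity>k\<in>F. \<sigma> x k * c k * cis (x * real_of_int k))"
    unfolding pdo_def fourier_coeff_trig_poly[OF assms]
    by (intro infsum_cong_neutral) auto
  then show ?thesis using assms by simp
qed

lemma pdo_trig_poly_measurable:
  assumes \<sigma>: "\<sigma> \<in> symbol_class m \<rho> \<delta>" and f: "trig_poly f"
  shows "pdo \<sigma> f \<in> borel_measurable borel"
proof -
  obtain F c where F: "finite F" and eq: "f = (\<lambda>x. \<Sum>j\<in>F. c j * cis (x * real_of_int j))"
    using f unfolding trig_poly_def by blast
  have [measurable]: "(\<lambda>x. \<sigma> x k) \<in> borel_measurable borel" for k
    by (rule symbol_measurable[OF \<sigma>])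
  have "pdo \<sigma> f = (\<lambda>x. \<Sum>k\<in>F. \<sigma> x k * c k * cis (x * real_of_int k))"
    unfolding eq by (rule ext) (rule pdo_trig_poly[OF F])
  then show ?thesis by simp
qed

lemma pdo_modulated:
  assumes "finite F"
  shows "pdo \<sigma> (\<lambda>x. cis (x * real_of_int k) * (\<Sum>j\<in>F. c j * cis (x * real_of_int j))) x
    = (\<Sum>j\<in>F. \<sigma> x (k + j) * (c j * cis (x * real_of_int (k + j))))"
proof -
  have inj: "inj_on ((+) k) F" by simp
  have "cis (x * real_of_int k) * (\<Sum>j\<in>F. c j * cis (x * real_of_int j))
      = (\<Sum>m\<in>(+) k ` F. c (m - k) * cis (x * real_of_int m))" for x
    unfolding modulated_trig_poly sum.reindex[OF inj] by simp
  then have "(\<lambda>x. cis (x * real_of_int k) * (\<Sum>j\<in>F. c j * cis (x * real_of_int j)))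
      = (\<lambda>x. \<Sum>m\<in>(+) k ` F. c (m - k) * cis (x * real_of_int m))" by (rule ext)
  then have "pdo \<sigma> (\<lambda>x. cis (x * real_of_int k) * (\<Sum>j\<in>F. c j * cis (x * real_of_int j))) x
      = (\<Sum>m\<in>(+) k ` F. \<sigma> x m * c (m - k) * cis (x * real_of_int m))"
    by (simp only: pdo_trig_poly[OF finite_imageI[OF assms]])
  then show ?thesis unfolding sum.reindex[OF inj] by (simp add: mult.assoc)
qed

text \<open>
  The operator multiplies the frequency \<open>k + j\<close> component by \<open>\<sigma>(\<cdot>, k + j)\<close>. Only the finitely many \<open>j\<close> in the
  spectrum of \<open>g\<close> occur, so all these factors can be replaced by \<open>\<sigma>(\<cdot>, k)\<close> at once.
\<close>

lemma pdo_on_modulated: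
  assumes \<sigma>: "\<sigma> \<in> symbol_class 0 1 0" and g: "trig_poly g" and e: "e > 0"
  shows "\<forall>\<^sub>F k in freq_at_infinity. \<forall>x.
    norm (\<sigma> x k * (cis (x * real_of_int k) * g x) - pdo \<sigma> (\<lambda>x. cis (x * real_of_int k) * g x) x) \<le> e"
proof -
  obtain F c where F: "finite F" and g_eq: "g = (\<lambda>x. \<Sum>j\<in>F. c j * cis (x * real_of_int j))"
    using g unfolding trig_poly_def by blast
  define M where "M = (\<Sum>j\<in>F. norm (c j)) + 1"
  have M: "M > 0" unfolding M_def by (intro add_nonneg_pos sum_nonneg) auto
  have "\<forall>\<^sub>F k in freq_at_infinity. \<forall>j\<in>F. \<forall>x. norm (\<sigma> x (k + j) - \<sigma> x k) < e / M"
    using e M by (intro eventually_ball_finite[OF F] ballI symbol_shift_small[OF \<sigma>]) simp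
  then show ?thesis
  proof eventually_elim
    case (elim k)
    show ?case
    proof
      fix x
      have "\<sigma> x k * (cis (x * real_of_int k) * g x) - pdo \<sigma> (\<lambda>x. cis (x * real_of_int k) * g x) x
          = (\<Sum>j\<in>F. (\<sigma> x k - \<sigma> x (k + j)) * (c j * cis (x * real_of_int (k + j))))"
        unfolding g_eq pdo_modulated[OF F] unfolding modulated_trig_poly
        by (simp only: sum_distrib_left sum_subtractf left_diff_distrib)
      also have "norm \<dots> \<le> (\<Sum>j\<in>F. e / M * norm (c j))"
      proof (rule sum_norm_le)
        fix j assume "j \<in> F"
        then have "norm (\<sigma> x k - \<sigma> x (k + j)) \<le> e / M"
          using elim by (metis norm_minus_commute less_imp_le)
        then show "norm ((\<sigma> x k - \<sigma> x (k + j)) * (c j * cis (x * real_of_int (k + j)))) \<le> e / M * norm (c j)"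
          unfolding norm_mult norm_cis mult_1_right by (intro mult_right_mono) auto
      qed
      also have "\<dots> = e / M * (M - 1)" by (simp add: M_def sum_distrib_left)
      also have "\<dots> \<le> e" using e M by (simp add: right_diff_distrib)
      finally show "norm (\<sigma> x k * (cis (x * real_of_int k) * g x)
          - pdo \<sigma> (\<lambda>x. cis (x * real_of_int k) * g x) x) \<le> e" .
    qed
  qed
qed

section \<open>The lower bound\<close>

theorem theorem2p1:
  fixes \<sigma> :: "real \<Rightarrow> int \<Rightarrow> complex"
    and p :: real
    and T K :: "(real \<Rightarrow> complex) \<Rightarrow> (real \<Rightarrow> complex)"
  assumes "\<sigma> \<in> symbol_class 0 1 0"
    and "1 < p"
    and "is_pdo_extension p \<sigma> T"
    and "compact_op p K"
  shows "ereal (op_norm p (\<lambda>f x. T f x - K f x)) \<ge> symbol_limsup \<sigma>"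
proof (rule ccontr)
  define A where "A = op_norm p (\<lambda>f x. T f x - K f x)"
  have p: "p > 0" "p \<ge> 1" using assms(2) by auto
  have bT: "bounded_op p T" and T: "\<And>f. trig_poly f \<Longrightarrow> AE x in circle. T f x = pdo \<sigma> f x"
    using assms(3) by (auto simp: is_pdo_extension_def)
  have bK: "bounded_op p K" using assms(4) by (simp add: compact_op_def)
  have A0: "A \<ge> 0"
    using order_trans[OF Lp_norm_nonneg op_norm_upper[OF bT bK p(2) zero_in_Lp_space]]
    by (simp add: A_def)
  assume "\<not> ereal (op_norm p (\<lambda>f x. T f x - K f x)) \<ge> symbol_limsup \<sigma>"
  then have "ereal A < symbol_limsup \<sigma>" by (simp add: A_def)
  then obtain c where c: "A < c" "\<And>N. \<exists>k x. \<bar>k\<bar> > N \<and> c < norm (\<sigma> x k)"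
    using frequently_symbol_large by blast
  obtain k :: "nat \<Rightarrow> int" and X x0 where k: "inj k" "filterlim k freq_at_infinity sequentially"
    and X: "X \<longlonglongrightarrow> x0" and x0: "x0 \<in> {0..2 * pi}"
    and big: "\<And>n. c < norm (\<sigma> (X n) (k n))"
    using large_symbol_sequence[OF assms(1) c(2)] by metis
  obtain L where L: "L > 0" "\<And>x y k. norm (\<sigma> x k - \<sigma> y k) \<le> L * \<bar>x - y\<bar>"
    using symbol_lipschitz[OF assms(1)] by metis

  \<comment> \<open>The gap between \<open>A\<close> and \<open>c\<close> is spent as follows: \<open>c - c1\<close> on the oscillation of the symbol near \<open>x0\<close>,
    the factor \<open>\<theta>\<close> on the mass of \<open>g\<close> elsewhere (it keeps \<open>\<theta> * c1 > A\<close>), and one third of what remains on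
    each of the image under \<open>K\<close> and the error of freezing the frequency.\<close>
  define c1 where "c1 = (A + c) / 2"
  define \<theta> where "\<theta> = (A + c1) / (2 * c1)"
  define \<eta> where "\<eta> = (\<theta> * c1 - A) / 3"
  have c1: "A < c1" "c1 < c" "c1 > 0" using c(1) A0 by (auto simp: c1_def)
  have \<theta>c1: "\<theta> * c1 = (A + c1) / 2" using c1 by (simp add: \<theta>_def)
  have \<theta>: "0 \<le> \<theta>" "\<theta> < 1" using A0 c1 by (simp_all add: \<theta>_def divide_less_eq)
  have \<eta>: "\<eta> > 0" using c1 by (simp add: \<eta>_def \<theta>c1)
  define \<epsilon> where "\<epsilon> = (c - c1) / (2 * L)"
  have \<epsilon>: "\<epsilon> > 0" "L * (2 * \<epsilon>) = c - c1" using L(1) c1 by (simp_all add: \<epsilon>_def)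

  \<comment> \<open>Cutting off at the ends of \<open>[0, 2\<pi>]\<close> leaves a proper interval even if \<open>x0\<close> is an endpoint.\<close>
  define a where "a = max 0 (x0 - \<epsilon>)"
  define b where "b = min (2 * pi) (x0 + \<epsilon>)"
  have ab: "0 \<le> a" "a < b" "b \<le> 2 * pi"
    using x0 \<epsilon>(1) pi_gt_zero by (auto simp: a_def b_def)
  obtain g where g: "trig_poly g" "Lp_norm p g = 1"
    and conc: "\<theta> \<le> Lp_norm p (\<lambda>x. indicator {a<..<b} x * g x)"
    using concentrated_trig_poly[OF p(1) ab \<theta>] by metis
  have gm [measurable]: "g \<in> borel_measurable borel" by (rule trig_poly_measurable[OF g(1)])
  obtain B where B: "\<And>x. norm (g x) \<le> B" using trig_poly_bounded[OF g(1)] by metis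
  obtain s where s: "strict_mono s" and
    Klim: "(\<lambda>n. Lp_norm p (K (\<lambda>x. cis (x * real_of_int (k (s n))) * g x))) \<longlonglongrightarrow> 0"
    using compact_op_high_frequency[OF assms(4,2) gm B _ k(1)] g(2) by auto

  have ks: "filterlim (\<lambda>n. k (s n)) freq_at_infinity sequentially"
    by (rule filterlim_compose[OF k(2) filterlim_subseq[OF s]])
  have "\<forall>\<^sub>F n in sequentially. Lp_norm p (K (\<lambda>x. cis (x * real_of_int (k (s n))) * g x)) < \<eta>"
    by (rule order_tendstoD(2)[OF Klim \<eta>])
  moreover have "\<forall>\<^sub>F n in sequentially. \<bar>X (s n) - x0\<bar> < \<epsilon>"
    using tendstoD[OF LIMSEQ_subseq_LIMSEQ[OF X s] \<epsilon>(1)] by (simp add: dist_real_def)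
  moreover have "\<forall>\<^sub>F n in sequentially. \<forall>x. norm (\<sigma> x (k (s n)) * (cis (x * real_of_int (k (s n))) * g x)
      - pdo \<sigma> (\<lambda>x. cis (x * real_of_int (k (s n))) * g x) x) \<le> \<eta>"
    by (rule eventually_compose_filterlim[OF pdo_on_modulated[OF assms(1) g(1) \<eta>] ks])
  ultimately have "\<forall>\<^sub>F n in sequentially. False"
  proof eventually_elim
    case (elim n)
    define m where "m = k (s n)"
    define f where "f = (\<lambda>x. cis (x * real_of_int m) * g x)"
    define v where "v = (\<lambda>x. \<sigma> x m * f x)"
    note elim = elim[folded m_def, folded f_def]
    have f: "trig_poly f" unfolding f_def by (rule trig_poly_modulate[OF g(1)])
    have fm [measurable]: "f \<in> borel_measurable borel" by (rule trig_poly_measurable[OF f])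
    have fB: "norm (f x) \<le> B" for x using B by (simp add: f_def norm_mult)
    have fL: "f \<in> Lp_space p" by (rule bounded_in_Lp_space[OF fm p(1) fB])
    have f1: "Lp_norm p f = 1" unfolding f_def Lp_norm_modulate by (rule g(2))
    have Tf: "T f \<in> Lp_space p" and Kf: "K f \<in> Lp_space p"
      using bounded_op_in_Lp[OF bT fL] bounded_op_in_Lp[OF bK fL] by auto
    have pm [measurable]: "pdo \<sigma> f \<in> borel_measurable borel"
      by (rule pdo_trig_poly_measurable[OF assms(1) f])
    have sm [measurable]: "(\<lambda>x. \<sigma> x m) \<in> borel_measurable borel"
      by (rule symbol_measurable[OF assms(1)])
    have vm [measurable]: "v \<in> borel_measurable borel" unfolding v_def by measurable
    have pL: "pdo \<sigma> f \<in> Lp_space p"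
      by (rule Lp_space_dominated[OF Tf pm p(1)]) (use T[OF f] in \<open>auto elim!: eventually_mono\<close>)
    have err: "norm (v x - pdo \<sigma> f x) \<le> \<eta>" for x
      using elim(3) by (simp add: v_def f_def)
    have errL: "(\<lambda>x. v x - pdo \<sigma> f x) \<in> Lp_space p"
      by (rule bounded_in_Lp_space[OF _ p(1) err]) measurable
    have vL: "v \<in> Lp_space p" using Lp_space_add[OF errL pL p(2)] by simp

    have "Lp_norm p v \<le> Lp_norm p (\<lambda>x. v x - pdo \<sigma> f x) + Lp_norm p (pdo \<sigma> f)"
      using Lp_norm_triangle[OF errL pL p(2)] by simp
    moreover have "Lp_norm p (\<lambda>x. v x - pdo \<sigma> f x) \<le> \<eta>"
      by (rule Lp_norm_le_bound[OF p(1) less_imp_le[OF \<eta>] err])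
    moreover have "Lp_norm p (pdo \<sigma> f) = Lp_norm p (T f)"
      by (rule Lp_norm_cong_AE[OF pL Tf p(1)]) (use T[OF f] in \<open>auto elim!: eventually_mono\<close>)
    moreover have "Lp_norm p (T f) \<le> Lp_norm p (\<lambda>x. T f x - K f x) + Lp_norm p (K f)"
      using Lp_norm_triangle[OF Lp_space_diff[OF Tf Kf p(2)] Kf p(2)] by simp
    moreover have "Lp_norm p (\<lambda>x. T f x - K f x) \<le> A"
      unfolding A_def by (rule op_norm_upper[OF bT bK p(2) fL]) (simp add: f1)
    ultimately have upper: "Lp_norm p v \<le> A + 2 * \<eta>" using elim(1) by linarith

    have sigma_big: "c1 \<le> norm (\<sigma> x m)" if x: "x \<in> {a<..<b}" for x
    proof -
      have "\<bar>X (s n) - x\<bar> \<le> 2 * \<epsilon>"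
        using elim(2) x by (auto simp: a_def b_def)
      then have "L * \<bar>X (s n) - x\<bar> \<le> L * (2 * \<epsilon>)" using L(1) by (intro mult_left_mono) auto
      then have "norm (\<sigma> (X (s n)) m - \<sigma> x m) \<le> c - c1"
        using L(2)[of "X (s n)" m x] \<epsilon>(2) by linarith
      moreover have "c < norm (\<sigma> (X (s n)) m)" unfolding m_def by (rule big)
      ultimately show ?thesis
        using norm_triangle_ineq2[of "\<sigma> (X (s n)) m" "\<sigma> x m"] by linarith
    qed
    have "c1 * Lp_norm p (\<lambda>x. indicator {a<..<b} x * g x)
        = Lp_norm p (\<lambda>x. of_real c1 * (indicator {a<..<b} x * g x))"
      unfolding Lp_norm_scale[OF p(1)] using c1 by simp
    also have "\<dots> \<le> Lp_norm p v"
    proof (rule Lp_norm_mono[OF vL p(1)], rule AE_I2)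
      fix x
      show "norm (of_real c1 * (indicator {a<..<b} x * g x)) \<le> norm (v x)"
        using sigma_big[of x] c1
        by (cases "x \<in> {a<..<b}") (auto simp: v_def f_def norm_mult mult_right_mono)
    qed
    finally have "\<theta> * c1 \<le> A + 2 * \<eta>"
      using upper mult_left_mono[OF conc less_imp_le[OF c1(3)]]
      unfolding mult.commute[of \<theta> c1] by linarith
    moreover have "\<theta> * c1 = A + 3 * \<eta>" using \<eta>_def by (simp add: field_simps)
    ultimately show False using \<eta> by linarith
  qed
  then show False by simp
qed

end
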